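(* Let $\tau:\mathbb{Z}/2\mathbb{Z}\to\mathcal{C}_2$ be a faithful representation, where $\mathcal{C}_2=\{I,-I\}\subset O(\mathbb{R}^2)$ is the group generated by the half-turn about the origin, let $G$ be a finite simple $\mathbb{Z}/2\mathbb{Z}$-symmetric graph with action $\theta:\mathbb{Z}/2\mathbb{Z}\to\mathrm{Aut}(G)$ free on $V(G)$, and let $(G,p)$ be a $\mathcal{C}_2$-regular framework in $\mathbb{R}^2$ with respect to $\theta$ and $\tau$. Then $$\operatorname{rank}R(G,p)=\operatorname{rank}\mathcal{M}_{2,3,1}(H,\psi)+\operatorname{rank}\mathcal{M}_{2,3,2}(H,\psi),$$ where $(H,\psi)$ denotes the quotient gain graph of $G$.
   Context: A framework $(G,p)$ in $\mathbb{R}^2$ is a finite simple graph $G$ with $p:V(G)\to\mathbb{R}^2$ such that $p(u)\ne p(v)$ for all edges $\{u,v\}$. The rigidity matrix $R(G,p)$ is the $|E(G)|\times 2|V(G)|$ matrix whose row for $\{u,v\}$ has $(p(u)-p(v))^\top$ in the columns of $u$, $(p(v)-p(u))^\top$ in the columns of $v$, and $0$ elsewhere. Let $\Gamma=\mathbb{Z}/2\mathbb{Z}$. An action is a homomorphism $\theta:\Gamma\to\mathrm{Aut}(G)$, written $\gamma v=\theta(\gamma)(v)$; free on $V(G)$ means no non-identity element fixes a vertex (edges may be fixed). $(G,p)$ is $\Gamma$-symmetric with respect to $\theta,\tau$ if $\tau(\gamma)p(v)=p(\gamma v)$ for all $\gamma,v$. It is $\mathcal{C}_2$-regular if it is $\Gamma$-symmetric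 and $\operatorname{rank}R(G,p)$ is maximal among all $\Gamma$-symmetric realizations of $G$ (with respect to the same $\theta,\tau$). Quotient gain graph $(H,\psi)$: choose one representative vertex in each vertex orbit. $V(H)$ is the set of vertex orbits, $E(H)$ the set of edge orbits; an edge orbit joining the orbits of representatives $u,v$ has the form $\{\{\gamma u,\gamma hv\}:\gamma\in\Gamma\}$ and is a directed edge (possibly a loop) from the orbit of $u$ to the orbit of $v$ with gain $\psi=h$. Gain-sparsity: a cycle (including loops and pairs of parallel edges) in $H$ is balanced if the product of its edge gains along the cycle (inverted for edges traversed backwards) is the identity. $F\subseteq E(H)$ is balanced if all its cycles are balanced. $V(F)$ is the set of endpoints of edges in $F$. An edge set $E$ is $(k,\ell,m)$-gain-sparse if $|F|\le k|V(F)|-\ell$ for every nonempty balanced $F\subseteq E$ and $|F|\le k|V(F)|-m$ for every nonempty $F\subseteq E$. For $m\in\{1,2\}$ the $(2,3,m)$-gain-sparse subsets of $E(H)$ are the independent sets of a matroid $\mathcal{M}_{2,3,m}(H,\psi)$ on $E(H)$; its rank is the maximum size of a $(2,3,m)$-gain-sparse subset of $E(H)$. *)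

theory Defs
  imports
    "HOL-Analysis.Analysis"
    "HOL-Algebra.Elementary_Groups"
    "HOL-Algebra.Group_Action"
    "Jordan_Normal_Form.DL_Rank"
    "Graph_Theory.Arc_Walk"
begin

section \<open>Frameworks and the rigidity matrix\<close>

definition simple_graph :: "'v set \<Rightarrow> 'v set set \<Rightarrow> bool" where
  "simple_graph V E \<longleftrightarrow> finite V \<and> (\<forall>e\<in>E. e \<subseteq> V \<and> card e = 2)"

definition is_framework :: "'v set \<Rightarrow> 'v set set \<Rightarrow> ('v \<Rightarrow> real^2) \<Rightarrow> bool" where
  "is_framework V E p \<longleftrightarrow>
     simple_graph V E \<and> (\<forall>u\<in>V. \<forall>v\<in>V. {u, v} \<in> E \<longrightarrow> p u \<noteq> p v)"

definition enumeration :: "'a set \<Rightarrow> 'a list" where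
  "enumeration A = (SOME xs. distinct xs \<and> set xs = A)"

text \<open>
  Row \<open>i\<close> belongs to the \<open>i\<close>-th edge; columns \<open>2 * k\<close> and \<open>2 * k + 1\<close> hold the two coordinates
  at the \<open>k\<close>-th vertex \<open>w\<close>. For an edge \<open>e\<close> at \<open>w\<close>, the other endpoint is the only
  element of \<open>e - {w}\<close>. The enumerations of edges and vertices are arbitrary; another choice
  only permutes rows and columns.
\<close>
definition rigidity_matrix :: "'v set \<Rightarrow> 'v set set \<Rightarrow> ('v \<Rightarrow> real^2) \<Rightarrow> real Matrix.mat" where
  "rigidity_matrix V E p =
     Matrix.mat (card E) (2 * card V) (\<lambda>(i, j).
       let e = enumeration E ! i;
           w = enumeration V ! (j div 2);
           k = (if even j then 1 else 2)
       in if w \<in> e then vec_nth (p w - p (the_elem (e - {w}))) k else 0)"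

definition rigidity_rank :: "'v set \<Rightarrow> 'v set set \<Rightarrow> ('v \<Rightarrow> real^2) \<Rightarrow> nat" where
  "rigidity_rank V E p = vec_space.rank (card E) (rigidity_matrix V E p)"


section \<open>Symmetric frameworks\<close>

definition graph_aut_group :: "'v set \<Rightarrow> 'v set set \<Rightarrow> ('v \<Rightarrow> 'v) monoid" where
  "graph_aut_group V E = BijGroup V
     \<lparr>carrier := {f \<in> Bij V. \<forall>u\<in>V. \<forall>v\<in>V. {u, v} \<in> E \<longleftrightarrow> {f u, f v} \<in> E}\<rparr>"

definition free_action :: "('g, 'm) monoid_scheme \<Rightarrow> 'v set \<Rightarrow> ('g \<Rightarrow> 'v \<Rightarrow> 'v) \<Rightarrow> bool" where
  "free_action \<Gamma> V \<theta> \<longleftrightarrow> (\<forall>g\<in>carrier \<Gamma>. g \<noteq> \<one>\<^bsub>\<Gamma>\<^esub> \<longrightarrow> (\<forall>v\<in>V. \<theta> g v \<noteq> v))"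

text \<open>The group generated by the half-turn about the origin, as a group of matrices.\<close>
definition half_turn_group :: "(real^2^2) monoid" where
  "half_turn_group =
     \<lparr>carrier = {Finite_Cartesian_Product.mat 1, - Finite_Cartesian_Product.mat 1},
      monoid.mult = (**), one = Finite_Cartesian_Product.mat 1\<rparr>"

definition symmetric_framework ::
  "('g, 'm) monoid_scheme \<Rightarrow> 'v set \<Rightarrow> 'v set set \<Rightarrow> ('g \<Rightarrow> 'v \<Rightarrow> 'v) \<Rightarrow> ('g \<Rightarrow> real^2^2) \<Rightarrow>
    ('v \<Rightarrow> real^2) \<Rightarrow> bool" where
  "symmetric_framework \<Gamma> V E \<theta> \<tau> p \<longleftrightarrow>
     is_framework V E p \<and> (\<forall>g\<in>carrier \<Gamma>. \<forall>v\<in>V. \<tau> g *v p v = p (\<theta> g v))"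

definition symmetric_regular ::
  "('g, 'm) monoid_scheme \<Rightarrow> 'v set \<Rightarrow> 'v set set \<Rightarrow> ('g \<Rightarrow> 'v \<Rightarrow> 'v) \<Rightarrow> ('g \<Rightarrow> real^2^2) \<Rightarrow>
    ('v \<Rightarrow> real^2) \<Rightarrow> bool" where
  "symmetric_regular \<Gamma> V E \<theta> \<tau> p \<longleftrightarrow>
     symmetric_framework \<Gamma> V E \<theta> \<tau> p \<and>
     (\<forall>q. symmetric_framework \<Gamma> V E \<theta> \<tau> q \<longrightarrow> rigidity_rank V E q \<le> rigidity_rank V E p)"


section \<open>Quotient gain graphs\<close>

text \<open>
  The directed multigraph \<open>H\<close> with gains \<open>\<psi>\<close> is a quotient gain graph if it arises from some
  choice \<open>r\<close> of orbit representatives and some choice of orientation of the edge orbits.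
\<close>
definition quotient_gain_graph ::
  "('g, 'm) monoid_scheme \<Rightarrow> 'v set \<Rightarrow> 'v set set \<Rightarrow> ('g \<Rightarrow> 'v \<Rightarrow> 'v) \<Rightarrow>
    ('v set, 'v set set) pre_digraph \<Rightarrow> ('v set set \<Rightarrow> 'g) \<Rightarrow> bool" where
  "quotient_gain_graph \<Gamma> V E \<theta> H \<psi> \<longleftrightarrow>
     verts H = orbits \<Gamma> V \<theta> \<and>
     arcs H = orbits \<Gamma> E (\<lambda>g e. \<theta> g ` e) \<and>
     (\<exists>r. (\<forall>X\<in>verts H. r X \<in> X) \<and>
       (\<forall>a\<in>arcs H. tail H a \<in> verts H \<and> head H a \<in> verts H \<and> \<psi> a \<in> carrier \<Gamma> \<and>
          a = {{\<theta> g (r (tail H a)), \<theta> (g \<otimes>\<^bsub>\<Gamma>\<^esub> \<psi> a) (r (head H a))} | g. g \<in> carrier \<Gamma>}))"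


section \<open>Gain sparsity\<close>

text \<open>
  Each edge \<open>e\<close> is replaced by two arcs: \<open>(e, True)\<close> traverses \<open>e\<close> forwards, \<open>(e, False)\<close>
  backwards.
\<close>
definition bidirect :: "('a, 'b) pre_digraph \<Rightarrow> ('a, 'b \<times> bool) pre_digraph" where
  "bidirect H =
     \<lparr>verts = verts H, arcs = arcs H \<times> UNIV,
      tail = (\<lambda>(e, fwd). if fwd then tail H e else head H e),
      head = (\<lambda>(e, fwd). if fwd then head H e else tail H e)\<rparr>"

text \<open>
  Distinctness of the underlying edges excludes traversing a single edge forwards and then
  backwards. Loops and pairs of parallel edges are cycles.
\<close>
definition undirected_cycle :: "('a, 'b) pre_digraph \<Rightarrow> ('b \<times> bool) list \<Rightarrow> bool" where
  "undirected_cycle H c \<longleftrightarrow> pre_digraph.cycle (bidirect H) c \<and> distinct (map fst c)"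

definition walk_gain :: "('g, 'm) monoid_scheme \<Rightarrow> ('b \<Rightarrow> 'g) \<Rightarrow> ('b \<times> bool) list \<Rightarrow> 'g" where
  "walk_gain \<Gamma> \<psi> c =
     foldr (\<lambda>(e, fwd) x. (if fwd then \<psi> e else inv\<^bsub>\<Gamma>\<^esub> \<psi> e) \<otimes>\<^bsub>\<Gamma>\<^esub> x) c \<one>\<^bsub>\<Gamma>\<^esub>"

definition balanced ::
  "('g, 'm) monoid_scheme \<Rightarrow> ('a, 'b) pre_digraph \<Rightarrow> ('b \<Rightarrow> 'g) \<Rightarrow> 'b set \<Rightarrow> bool" where
  "balanced \<Gamma> H \<psi> F \<longleftrightarrow>
     (\<forall>c. undirected_cycle H c \<and> fst ` set c \<subseteq> F \<longrightarrow> walk_gain \<Gamma> \<psi> c = \<one>\<^bsub>\<Gamma>\<^esub>)"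

definition edge_ends :: "('a, 'b) pre_digraph \<Rightarrow> 'b set \<Rightarrow> 'a set" where
  "edge_ends H F = tail H ` F \<union> head H ` F"

definition gain_sparse ::
  "('g, 'm) monoid_scheme \<Rightarrow> ('a, 'b) pre_digraph \<Rightarrow> ('b \<Rightarrow> 'g) \<Rightarrow> nat \<Rightarrow> nat \<Rightarrow> nat \<Rightarrow>
    'b set \<Rightarrow> bool" where
  "gain_sparse \<Gamma> H \<psi> k l m I \<longleftrightarrow>
     (\<forall>F\<subseteq>I. F \<noteq> {} \<longrightarrow>
        (balanced \<Gamma> H \<psi> F \<longrightarrow> int (card F) \<le> int k * int (card (edge_ends H F)) - int l) \<and>
        int (card F) \<le> int k * int (card (edge_ends H F)) - int m)"

definition gain_matroid_rank ::
  "('g, 'm) monoid_scheme \<Rightarrow> ('a, 'b) pre_digraph \<Rightarrow> ('b \<Rightarrow> 'g) \<Rightarrow> nat \<Rightarrow> nat \<Rightarrow> nat \<Rightarrow> nat" where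
  "gain_matroid_rank \<Gamma> H \<psi> k l m = Max {card I | I. I \<subseteq> arcs H \<and> gain_sparse \<Gamma> H \<psi> k l m I}"

end

theory Submission
  imports Defs "HOL-Library.Function_Algebras"
begin

text \<open>
  For a centrally symmetric placement the rows of the rigidity matrix split into a symmetric and an
  antisymmetric part, indexed by the arcs \<open>a = (X, Y)\<close> of the quotient: with \<open>\<epsilon> = \<plusminus>1\<close> the sign of the gain
  and \<open>d = P X - \<epsilon> P Y\<close>, the symmetric row is \<open>d \<otimes> (X - \<epsilon> Y)\<close> and the antisymmetric one is \<open>d \<otimes> (X - Y)\<close>.

  Independent symmetric (antisymmetric) rows are (2,3,1)- (respectively (2,3,2)-) sparse because
  they are orthogonal to the rotation (respectively to the two translations), and to all three
  trivial motions, switched by a potential, on a balanced edge set.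

  Conversely, both kinds of sparse sets are realized by prescribing the directions of the vectors
  \<open>d\<close>, following Whiteley's proof of Laman's theorem. For a prescribed direction per edge the
  rows have the form \<open>n \<otimes> b\<close>, and a matroid partition argument produces independent rows from the count
  \<open>|F| \<le> 2 dim (span (b ` F))\<close>. Sparsity gives this count for the signed incidence vectors even after
  doubling any edge, so for generic directions there is a placement \<open>P\<close> with these directions and no
  collapsed edge. Independence is preserved along all but finitely many points of a line of
  placements, so a single placement realizes both maximum sparse sets.
\<close>
section \<open>Independent families in real function spaces\<close>

text \<open>The row of an arc is \<open>d\<close> times an incidence function, but \<open>d\<close>
  is computed from the placement, so the rows of different arcs cannot be varied independently.
  Prescribing directions removes this coupling: directions are free, and only their realizability by
  a placement remains. That is a linear system whose solutions might all collapse an edge; doubling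
  an edge without losing independence is what rules this out, and it costs one unit in the count,
  which both sparsity conditions can pay. This system always involves the signed incidence
  functions, even when the desired rows are antisymmetric and use the unsigned ones.

  An edge fixed by the half-turn becomes a loop of sign -1. Its orbit has one edge, its
  antisymmetric row is zero, and a single loop passes the count 2 * 1 - 1 but not 2 * 1 - 2.

  Genericity is not expressed by algebraically independent coordinates: it means that on every line
  through a good point all but finitely many points are good. Division-free row elimination with
  polynomial entries supplies this in place of determinants.\<close>

instantiation "fun" :: (type, real_vector) real_vector
begin

definition scaleR_fun :: "real \<Rightarrow> ('a \<Rightarrow> 'b) \<Rightarrow> 'a \<Rightarrow> 'b" where
  "scaleR_fun c f = (\<lambda>x. c *\<^sub>R f x)"

instance
  by standard (auto simp: scaleR_fun_def fun_eq_iff algebra_simps)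

end

lemma scaleR_fun_apply [simp]: "(c *\<^sub>R f) x = c *\<^sub>R f x"
  by (simp add: scaleR_fun_def)

lemma sum_fun_apply: "(\<Sum>i\<in>I. w i) x = (\<Sum>i\<in>I. w i x)"
  by (induction I rule: infinite_finite_induct) auto

text \<open>Indexed, rather than a property of the image set: distinct arcs may have equal rows, and
  these must count as dependent.\<close>

definition indep_family :: "'i set \<Rightarrow> ('i \<Rightarrow> 'a::real_vector) \<Rightarrow> bool" where
  "indep_family I w \<longleftrightarrow> (\<forall>c. (\<Sum>i\<in>I. c i *\<^sub>R w i) = 0 \<longrightarrow> (\<forall>i\<in>I. c i = 0))"

lemma indep_familyD:
  "indep_family I w \<Longrightarrow> (\<Sum>i\<in>I. c i *\<^sub>R w i) = 0 \<Longrightarrow> i \<in> I \<Longrightarrow> c i = 0"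
  unfolding indep_family_def by blast

lemma indep_family_iff:
  assumes "finite I"
  shows "indep_family I w \<longleftrightarrow> inj_on w I \<and> independent (w ` I)"
proof
  assume ind: "indep_family I w"
  have inj: "inj_on w I"
  proof (rule inj_onI, rule ccontr)
    fix i j assume ij: "i \<in> I" "j \<in> I" "w i = w j" "i \<noteq> j"
    define c :: "'a \<Rightarrow> real" where "c = (\<lambda>k. if k = i then 1 else if k = j then -1 else 0)"
    have "(\<Sum>k\<in>I. c k *\<^sub>R w k) = (\<Sum>k\<in>{i,j}. c k *\<^sub>R w k)"
      by (rule sum.mono_neutral_right) (use assms ij in \<open>auto simp: c_def\<close>)
    also have "\<dots> = 0" using ij by (simp add: c_def)
    finally have "c i = 0" using indep_familyD[OF ind _ ij(1), of c] by simp
    then show False by (simp add: c_def)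
  qed
  have "independent (w ` I)"
    unfolding independent_explicit_finite_subsets
  proof (intro allI impI ballI)
    fix S u v assume S: "S \<subseteq> w ` I" "finite S" "(\<Sum>v\<in>S. u v *\<^sub>R v) = 0" "v \<in> S"
    define c where "c = (\<lambda>i. if w i \<in> S then u (w i) else 0)"
    have "(\<Sum>i\<in>I. c i *\<^sub>R w i) = (\<Sum>v\<in>w ` I. (if v \<in> S then u v else 0) *\<^sub>R v)"
      unfolding c_def by (rule sum.reindex_cong[OF inj, symmetric]) auto
    also have "\<dots> = (\<Sum>v\<in>S. (if v \<in> S then u v else 0) *\<^sub>R v)"
      by (rule sum.mono_neutral_right) (use assms S in auto)
    also have "\<dots> = 0" using S(3) by simp
    finally have "\<forall>i\<in>I. c i = 0" using ind unfolding indep_family_def by blast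
    then show "u v = 0" using S(1,4) unfolding c_def by (metis (no_types, lifting) imageE subsetD)
  qed
  with inj show "inj_on w I \<and> independent (w ` I)" by simp
next
  assume *: "inj_on w I \<and> independent (w ` I)"
  show "indep_family I w" unfolding indep_family_def
  proof (intro allI impI ballI)
    fix c i assume c: "(\<Sum>i\<in>I. c i *\<^sub>R w i) = 0" and i: "i \<in> I"
    have "(\<Sum>v\<in>w ` I. c (the_inv_into I w v) *\<^sub>R v) = (\<Sum>i\<in>I. c i *\<^sub>R w i)"
      using * by (simp add: sum.reindex the_inv_into_f_f)
    with c have "(\<Sum>v\<in>w ` I. c (the_inv_into I w v) *\<^sub>R v) = 0" by simp
    moreover have "(\<Sum>v\<in>w ` I. u v *\<^sub>R v) = 0 \<longrightarrow> (\<forall>v\<in>w ` I. u v = 0)" for u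
      using conjunct2[OF *, unfolded independent_explicit_finite_subsets, THEN spec, of "w ` I"]
        finite_imageI[OF assms, of w] by blast
    ultimately have "c (the_inv_into I w (w i)) = 0" using i by (metis imageI)
    then show "c i = 0" using * i by (simp add: the_inv_into_f_f)
  qed
qed

lemma indep_family_mono: "finite I \<Longrightarrow> indep_family I w \<Longrightarrow> J \<subseteq> I \<Longrightarrow> indep_family J w"
  by (meson indep_family_iff finite_subset image_mono inj_on_subset independent_mono)

lemma indep_family_card_le:
  assumes "finite I" "indep_family I w" "finite T" "w ` I \<subseteq> span T"
  shows "card I \<le> card T"
  using assms indep_family_iff[of I w] independent_span_bound[of T "w ` I"] card_image[of w I]
  by auto

lemma ex_basis_subset:
  fixes A :: "'a::real_vector set"
  obtains B where "B \<subseteq> A" "independent B" "A \<subseteq> span B" "card B = dim A"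
  using real_vector.basis_exists[of A] by (metis)

lemma indep_family_card_le_dim:
  assumes "finite I" "indep_family I w" "finite S" "w ` I \<subseteq> span S"
  shows "card I \<le> dim S"
proof -
  obtain B where B: "B \<subseteq> S" "S \<subseteq> span B" "card B = dim S"
    using ex_basis_subset by metis
  have "w ` I \<subseteq> span B" using assms(4) B(2) by (metis order_trans span_minimal subspace_span)
  then show ?thesis using indep_family_card_le[OF assms(1,2), of B] B assms(3) finite_subset by metis
qed

lemma dim_le_dim_if_span:
  fixes A B :: "'a::real_vector set"
  assumes "finite B" "A \<subseteq> span B" shows "dim A \<le> dim B"
proof -
  obtain C where C: "C \<subseteq> B" "B \<subseteq> span C" "card C = dim B"
    using ex_basis_subset by metis
  have "A \<subseteq> span C" using assms(2) C(2) by (metis order_trans span_minimal subspace_span)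
  then show ?thesis using real_vector.dim_le_card[of A C] C assms(1) finite_subset by metis
qed

lemma dim_mono_finite:
  fixes A B :: "'a::real_vector set"
  shows "finite B \<Longrightarrow> A \<subseteq> B \<Longrightarrow> dim A \<le> dim B"
  by (meson dim_le_dim_if_span span_superset subset_trans)

lemma dim_image_le_card:
  fixes w :: "'i \<Rightarrow> 'a::real_vector"
  assumes "finite I" shows "dim (w ` I) \<le> card I"
  using real_vector.dim_le_card[of "w ` I" "w ` I"] assms card_image_le[of I w] span_superset
  by (metis finite_imageI le_trans)

lemma obtain_indep_subfamily:
  fixes w :: "'i \<Rightarrow> 'a::real_vector"
  assumes "finite I"
  obtains J where "J \<subseteq> I" "indep_family J w" "card J = dim (w ` I)" "w ` I \<subseteq> span (w ` J)"
proof -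
  obtain B where B: "B \<subseteq> w ` I" "independent B" "w ` I \<subseteq> span B" "card B = dim (w ` I)"
    using ex_basis_subset by metis
  then obtain J where J: "J \<subseteq> I" "inj_on w J" "B = w ` J" by (meson subset_image_inj)
  show ?thesis using that[of J] J B assms
    by (metis card_image finite_subset indep_family_iff)
qed

lemma indep_family_if_dim:
  assumes "finite I" "card I \<le> dim (w ` I)"
  shows "indep_family I w"
proof -
  obtain J where J: "J \<subseteq> I" "indep_family J w" "card J = dim (w ` I)"
    using obtain_indep_subfamily[OF assms(1)] by metis
  then have "J = I" using assms by (metis card_seteq)
  with J show ?thesis by simp
qed

text \<open>A basis of \<open>A \<inter> B\<close> extends to bases of \<open>A\<close> and of
  \<open>B\<close>, whose union spans \<open>A \<union> B\<close> and whose intersection contains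
  it. The intersection is that of sets, not of spans: this is submodularity of the rank function of
  a linear matroid.\<close>

lemma dim_submodular:
  fixes A B :: "'a::real_vector set"
  assumes "finite A" "finite B"
  shows "dim (A \<union> B) + dim (A \<inter> B) \<le> dim A + dim B"
proof -
  obtain C where C: "C \<subseteq> A \<inter> B" "independent C" "A \<inter> B \<subseteq> span C" "card C = dim (A \<inter> B)"
    using ex_basis_subset by metis
  obtain CA where CA: "C \<subseteq> CA" "CA \<subseteq> A" "independent CA" "A \<subseteq> span CA"
    using maximal_independent_subset_extend[of C A] C by auto
  obtain CB where CB: "C \<subseteq> CB" "CB \<subseteq> B" "independent CB" "B \<subseteq> span CB"
    using maximal_independent_subset_extend[of C B] C by auto
  have fin: "finite CA" "finite CB" "finite C"
    using assms CA CB finite_subset by metis+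
  have cA: "card CA = dim A" using real_vector.basis_card_eq_dim[OF CA(2) CA(4) CA(3)] .
  have cB: "card CB = dim B" using real_vector.basis_card_eq_dim[OF CB(2) CB(4) CB(3)] .
  have "A \<union> B \<subseteq> span (CA \<union> CB)"
    using CA(4) CB(4) span_mono[of CA "CA \<union> CB"] span_mono[of CB "CA \<union> CB"] by auto
  then have "dim (A \<union> B) \<le> card (CA \<union> CB)" using fin by (simp add: real_vector.dim_le_card)
  moreover have "card (CA \<union> CB) + card (CA \<inter> CB) = card CA + card CB"
    using card_Un_Int fin by metis
  moreover have "card C \<le> card (CA \<inter> CB)" using CA CB fin by (intro card_mono) auto
  ultimately show ?thesis using C cA cB by linarith
qed

section \<open>Matroid partition and generic points\<close>

text \<open>One step of Gaussian elimination: column \<open>j0\<close> is cleared from the other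
  rows. Cross-multiplying instead of dividing keeps polynomial entries polynomial.\<close>

lemma indep_family_pivot:
  fixes w :: "'i \<Rightarrow> 'c \<Rightarrow> real"
  assumes fin: "finite I" and i0: "i0 \<notin> I" and piv: "w i0 j0 \<noteq> 0"
  shows "indep_family (insert i0 I) w \<longleftrightarrow> indep_family I (\<lambda>i j. w i0 j0 * w i j - w i j0 * w i0 j)"
    (is "_ \<longleftrightarrow> indep_family I ?w")
proof
  assume ind: "indep_family (insert i0 I) w"
  show "indep_family I ?w" unfolding indep_family_def
  proof (intro allI impI ballI)
    fix c i assume c: "(\<Sum>i\<in>I. c i *\<^sub>R ?w i) = 0" and i: "i \<in> I"
    \<comment> \<open>The coefficients of the original rows after expanding the eliminated ones;
      \<open>d i0\<close> collects all multiples of \<open>w i0\<close>.\<close>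
    define d where "d = (\<lambda>k. if k = i0 then - (\<Sum>i\<in>I. c i * w i j0) else w i0 j0 * c k)"
    have "(\<Sum>k\<in>insert i0 I. d k *\<^sub>R w k) j = 0" for j
    proof -
      have "0 = (\<Sum>i\<in>I. c i *\<^sub>R ?w i) j" using c by simp
      also have "\<dots> = (\<Sum>i\<in>I. d i * w i j + (- (c i * w i j0)) * w i0 j)"
        unfolding sum_fun_apply by (rule sum.cong) (use i0 in \<open>auto simp: d_def algebra_simps\<close>)
      also have "\<dots> = (\<Sum>i\<in>I. d i * w i j) + d i0 * w i0 j"
        by (simp add: d_def sum.distrib sum_distrib_right sum_negf sum_subtractf)
      finally show ?thesis using fin i0 by (simp add: sum_fun_apply)
    qed
    then have "(\<Sum>k\<in>insert i0 I. d k *\<^sub>R w k) = 0" by (simp add: fun_eq_iff)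
    then have "d i = 0" by (rule indep_familyD[OF ind]) (use i in simp)
    then show "c i = 0" using i i0 piv by (auto simp: d_def split: if_splits)
  qed
next
  assume ind: "indep_family I ?w"
  show "indep_family (insert i0 I) w" unfolding indep_family_def
  proof (intro allI impI)
    fix c assume c: "(\<Sum>i\<in>insert i0 I. c i *\<^sub>R w i) = 0"
    have ev: "(\<Sum>i\<in>I. c i * w i j) = - c i0 * w i0 j" for j
      using fun_cong[OF c, of j] fin i0 by (simp add: sum_fun_apply add_eq_0_iff)
    have "(\<Sum>i\<in>I. c i *\<^sub>R ?w i) j = 0" for j
    proof -
      have "(\<Sum>i\<in>I. c i *\<^sub>R ?w i) j
          = w i0 j0 * (\<Sum>i\<in>I. c i * w i j) - w i0 j * (\<Sum>i\<in>I. c i * w i j0)"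
        by (simp add: sum_fun_apply sum_distrib_left sum_subtractf[symmetric] algebra_simps)
      also have "\<dots> = 0" by (simp add: ev)
      finally show ?thesis .
    qed
    then have "(\<Sum>i\<in>I. c i *\<^sub>R ?w i) = 0" by (simp add: fun_eq_iff)
    then have z: "c i = 0" if "i \<in> I" for i using indep_familyD[OF ind] that by blast
    then have "c i0 * w i0 j0 = 0" using ev[of j0] by simp
    with z piv show "\<forall>i\<in>insert i0 I. c i = 0" by simp
  qed
qed

lemma indep_family_nonzero:
  fixes w :: "'i \<Rightarrow> 'c \<Rightarrow> real"
  assumes "finite I" "indep_family I w" "i \<in> I"
  obtains j where "w i j \<noteq> 0"
proof -
  have "\<exists>j. w i j \<noteq> 0"
  proof (rule ccontr)
    assume "\<not> ?thesis"
    then have "w i = 0" by (simp add: fun_eq_iff)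
    then show False
      using assms indep_family_iff[of I w] dependent_zero[of "w ` I"]
      by (metis imageI)
  qed
  with that show thesis by blast
qed

text \<open>Full row rank makes a linear system solvable for every right-hand side; elimination and
  back substitution, one row at a time.\<close>

lemma indep_family_solvable:
  fixes w :: "'i \<Rightarrow> 'c \<Rightarrow> real"
  assumes "finite I" "finite C" "indep_family I w" "\<And>i j. i \<in> I \<Longrightarrow> j \<notin> C \<Longrightarrow> w i j = 0"
  shows "\<exists>x. \<forall>i\<in>I. (\<Sum>j\<in>C. w i j * x j) = y i"
  using assms(1,3,4)
proof (induction I arbitrary: w y rule: finite_induct)
  case empty
  then show ?case by simp
next
  case (insert i0 I)
  obtain j0 where j0: "w i0 j0 \<noteq> 0"
    using indep_family_nonzero[OF _ insert.prems(1), of i0] insert.hyps by auto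
  then have j0C: "j0 \<in> C" using insert.prems(2) by blast
  define v where "v = (\<lambda>i j. w i0 j0 * w i j - w i j0 * w i0 j)"
  have "indep_family I v"
    using indep_family_pivot[OF insert.hyps(1,2), of w j0] j0 insert.prems(1) by (simp add: v_def)
  moreover have "v i j = 0" if "i \<in> I" "j \<notin> C" for i j
    using insert.prems(2) that by (simp add: v_def)
  ultimately obtain x where x: "\<forall>i\<in>I. (\<Sum>j\<in>C. v i j * x j) = w i0 j0 * y i - w i j0 * y i0"
    using insert.IH[of v "\<lambda>i. w i0 j0 * y i - w i j0 * y i0"] by blast
  \<comment> \<open>Only coordinate \<open>j0\<close> is corrected, to satisfy equation
    \<open>i0\<close>. The eliminated rows vanish at \<open>j0\<close>, so their equations
    survive.\<close>
  define z where "z = x(j0 := x j0 + (y i0 - (\<Sum>j\<in>C. w i0 j * x j)) / w i0 j0)"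
  have upd: "(\<Sum>j\<in>C. u j * z j) = (\<Sum>j\<in>C. u j * x j) + u j0 * (z j0 - x j0)" for u
  proof -
    have "(\<Sum>j\<in>C. u j * z j) - (\<Sum>j\<in>C. u j * x j) = (\<Sum>j\<in>C. u j * (z j - x j))"
      by (simp add: sum_subtractf algebra_simps)
    also have "\<dots> = (\<Sum>j\<in>{j0}. u j * (z j - x j))"
      by (rule sum.mono_neutral_right) (use assms(2) j0C in \<open>auto simp: z_def\<close>)
    finally show ?thesis by simp
  qed
  have z0: "(\<Sum>j\<in>C. w i0 j * z j) = y i0"
    unfolding upd using j0 by (simp add: z_def)
  have "(\<Sum>j\<in>C. w i j * z j) = y i" if i: "i \<in> I" for i
  proof -
    have "w i0 j0 * (\<Sum>j\<in>C. w i j * z j) = (\<Sum>j\<in>C. v i j * z j) + w i j0 * (\<Sum>j\<in>C. w i0 j * z j)"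
      by (simp add: v_def sum_distrib_left sum.distrib[symmetric] algebra_simps)
    also have "(\<Sum>j\<in>C. v i j * z j) = w i0 j0 * y i - w i j0 * y i0"
      using x i unfolding upd by (simp add: v_def)
    finally show ?thesis using j0 by (simp add: z0)
  qed
  with z0 show ?case by auto
qed

text \<open>A pivot that is nonzero at \<open>t0\<close> is a nonzero polynomial with finitely many
  roots. Away from these, independence is equivalent to that of the eliminated, still polynomial,
  rows.\<close>

lemma finite_dependent_parameters:
  fixes P :: "'i \<Rightarrow> 'c \<Rightarrow> real poly"
  assumes "finite I" "indep_family I (\<lambda>i j. poly (P i j) t0)"
  shows "finite {t. \<not> indep_family I (\<lambda>i j. poly (P i j) t)}"
  using assms
proof (induction I arbitrary: P rule: finite_induct)
  case empty
  then show ?case by (simp add: indep_family_def)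
next
  case (insert i0 I)
  obtain j0 where j0: "poly (P i0 j0) t0 \<noteq> 0"
    using indep_family_nonzero[OF _ insert.prems, of i0] insert.hyps by auto
  define Q where "Q = (\<lambda>i j. P i0 j0 * P i j - P i j0 * P i0 j)"
  have piv: "indep_family (insert i0 I) (\<lambda>i j. poly (P i j) t) \<longleftrightarrow> indep_family I (\<lambda>i j. poly (Q i j) t)"
    if "poly (P i0 j0) t \<noteq> 0" for t
    using indep_family_pivot[OF insert.hyps(1,2), of "\<lambda>i j. poly (P i j) t" j0] that
    by (simp add: Q_def)
  have "finite {t. \<not> indep_family I (\<lambda>i j. poly (Q i j) t)}"
    using insert.IH[of Q] insert.prems piv[OF j0] by blast
  moreover have "finite {t. poly (P i0 j0) t = 0}"
    using j0 by (intro poly_roots_finite) auto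
  moreover have "{t. \<not> indep_family (insert i0 I) (\<lambda>i j. poly (P i j) t)}
      \<subseteq> {t. poly (P i0 j0) t = 0} \<union> {t. \<not> indep_family I (\<lambda>i j. poly (Q i j) t)}"
    using piv by auto
  ultimately show ?case by (meson finite_UnI finite_subset)
qed

text \<open>Starting from overlapping candidate classes, a common element is deleted from one of
  them as long as the count survives. If neither deletion is possible, the two violating sets are
  uncrossed by submodularity. Once the classes are disjoint, the count for \<open>S\<close> itself
  forces both to be independent.\<close>

lemma matroid_partition_aux:
  fixes a :: "'i \<Rightarrow> 'a::real_vector"
  assumes "finite S" "S1 \<union> S2 = S"
    and "\<And>F. F \<subseteq> S \<Longrightarrow> card F \<le> dim (a ` (F \<inter> S1)) + dim (a ` (F \<inter> S2))"
  shows "\<exists>T1 T2. T1 \<union> T2 = S \<and> T1 \<inter> T2 = {} \<and> indep_family T1 a \<and> indep_family T2 a"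
  using assms
proof (induction "card (S1 \<inter> S2)" arbitrary: S1 S2 rule: less_induct)
  case less
  note hall = less.prems(3)
  have fin: "finite S1" "finite S2" using less.prems(1,2) by auto
  show ?case
  proof (cases "S1 \<inter> S2 = {}")
    case True
    have "S \<inter> S1 = S1" "S \<inter> S2 = S2" using less.prems(2) by auto
    then have "card S \<le> dim (a ` S1) + dim (a ` S2)" using hall[of S] by simp
    moreover have "card S = card S1 + card S2" using True less.prems(2) fin card_Un_disjoint by blast
    moreover have "dim (a ` S1) \<le> card S1" "dim (a ` S2) \<le> card S2"
      using fin by (simp_all add: dim_image_le_card)
    ultimately have "indep_family S1 a" "indep_family S2 a"
      using fin by (auto intro!: indep_family_if_dim)
    then show ?thesis using True less.prems(2) by blast
  next
    case False
    then obtain e where e: "e \<in> S1" "e \<in> S2" by blast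
    define S1' where "S1' = S1 - {e}"
    define S2' where "S2' = S2 - {e}"
    have dec: "card (S1' \<inter> S2) < card (S1 \<inter> S2)" "card (S1 \<inter> S2') < card (S1 \<inter> S2)"
      using e fin by (auto simp: S1'_def S2'_def intro!: psubset_card_mono)
    have un: "S1' \<union> S2 = S" "S1 \<union> S2' = S" using e less.prems(2) by (auto simp: S1'_def S2'_def)
    show ?thesis
    proof (cases "\<forall>F\<subseteq>S. card F \<le> dim (a ` (F \<inter> S1')) + dim (a ` (F \<inter> S2))")
      case True
      then show ?thesis using less.hyps[OF dec(1) less.prems(1) un(1)] by blast
    next
      case False
      then obtain F where F: "F \<subseteq> S" "card F > dim (a ` (F \<inter> S1')) + dim (a ` (F \<inter> S2))"
        by (meson not_le)
      have "\<forall>F\<subseteq>S. card F \<le> dim (a ` (F \<inter> S1)) + dim (a ` (F \<inter> S2'))"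
      proof (rule ccontr)
        assume "\<not> ?thesis"
        then obtain F' where F': "F' \<subseteq> S" "card F' > dim (a ` (F' \<inter> S1)) + dim (a ` (F' \<inter> S2'))"
          by (meson not_le)
        have sub: "dim (a ` (X \<union> Y)) + dim (a ` Z) \<le> dim (a ` X) + dim (a ` Y)"
          if "X \<subseteq> S" "Y \<subseteq> S" "Z \<subseteq> X \<inter> Y" for X Y Z
        proof -
          have fin': "finite (a ` X)" "finite (a ` Y)"
            using that less.prems(1) finite_subset by blast+
          have "dim (a ` Z) \<le> dim (a ` X \<inter> a ` Y)"
            using that fin' by (intro dim_mono_finite) auto
          with dim_submodular[OF fin'] show ?thesis by (simp add: image_Un)
        qed
        have eF: "e \<in> F"
        proof (rule ccontr)
          assume "e \<notin> F"
          then have "F \<inter> S1' = F \<inter> S1" by (auto simp: S1'_def)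
          with F hall[of F] show False by simp
        qed
        have eF': "e \<in> F'"
        proof (rule ccontr)
          assume "e \<notin> F'"
          then have "F' \<inter> S2' = F' \<inter> S2" by (auto simp: S2'_def)
          with F' hall[of F'] show False by simp
        qed
        \<comment> \<open>Removing \<open>e\<close> from the intersection loses one element, whereas
          the two strict violations gain two; so the counts for \<open>?U\<close> and
          \<open>?N\<close> cannot both hold.\<close>
        let ?U = "F \<union> F'" and ?N = "F \<inter> F' - {e}"
        have "dim (a ` (?U \<inter> S1)) + dim (a ` (?N \<inter> S1)) \<le> dim (a ` (F \<inter> S1')) + dim (a ` (F' \<inter> S1))"
        proof -
          have "?U \<inter> S1 = (F \<inter> S1') \<union> (F' \<inter> S1)" using eF' e by (auto simp: S1'_def)
          then show ?thesis using sub[of "F \<inter> S1'" "F' \<inter> S1" "?N \<inter> S1"] F(1) F'(1)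
            by (auto simp: S1'_def)
        qed
        moreover have "dim (a ` (?U \<inter> S2)) + dim (a ` (?N \<inter> S2)) \<le> dim (a ` (F \<inter> S2)) + dim (a ` (F' \<inter> S2'))"
        proof -
          have "?U \<inter> S2 = (F \<inter> S2) \<union> (F' \<inter> S2')" using eF e by (auto simp: S2'_def)
          then show ?thesis using sub[of "F \<inter> S2" "F' \<inter> S2'" "?N \<inter> S2"] F(1) F'(1)
            by (auto simp: S2'_def)
        qed
        moreover have "card ?U \<le> dim (a ` (?U \<inter> S1)) + dim (a ` (?U \<inter> S2))"
          using hall[of ?U] F(1) F'(1) by blast
        moreover have "card ?N \<le> dim (a ` (?N \<inter> S1)) + dim (a ` (?N \<inter> S2))"
          using hall[of ?N] F(1) by blast
        moreover have "card ?U + card ?N + 1 = card F + card F'"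
        proof -
          have f: "finite F" "finite F'" using F(1) F'(1) less.prems(1) finite_subset by blast+
          have "card (F \<inter> F') = card ?N + 1" using eF eF' f
            by (metis IntI Suc_eq_plus1 card_Suc_Diff1 finite_Int)
          with card_Un_Int[OF f] show ?thesis by simp
        qed
        ultimately show False using F(2) F'(2) by linarith
      qed
      then show ?thesis using less.hyps[OF dec(2) less.prems(1) un(2)] by blast
    qed
  qed
qed

lemma matroid_partition:
  fixes a :: "'i \<Rightarrow> 'a::real_vector"
  assumes "finite S" and "\<And>F. F \<subseteq> S \<Longrightarrow> card F \<le> 2 * dim (a ` F)"
  obtains S1 S2 where "S1 \<union> S2 = S" "S1 \<inter> S2 = {}" "indep_family S1 a" "indep_family S2 a"
proof -
  have "card F \<le> dim (a ` (F \<inter> S)) + dim (a ` (F \<inter> S))" if "F \<subseteq> S" for F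
    using assms(2)[OF that] that by (simp add: Int_absorb2)
  from matroid_partition_aux[OF assms(1), of S S a, OF _ this] that show thesis by blast
qed

definition tensor :: "real^2 \<Rightarrow> ('x \<Rightarrow> real) \<Rightarrow> 'x \<times> 2 \<Rightarrow> real" where
  "tensor d a = (\<lambda>(x, k). vec_nth d k * a x)"

text \<open>One class of a partition into two independent sets gets the first axis as direction, the
  other class the second, so the two coordinates of a relation separate.\<close>

lemma ex_indep_tensor_directions:
  fixes a :: "'i \<Rightarrow> 'x \<Rightarrow> real"
  assumes fin: "finite S" and hall: "\<And>F. F \<subseteq> S \<Longrightarrow> card F \<le> 2 * dim (a ` F)"
  shows "\<exists>n :: 'i \<Rightarrow> real^2. indep_family S (\<lambda>i. tensor (n i) (a i))"
proof -
  obtain S1 S2 where S: "S1 \<union> S2 = S" "S1 \<inter> S2 = {}" "indep_family S1 a" "indep_family S2 a"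
    using matroid_partition[OF fin, of a] hall by metis
  have finS: "finite S1" "finite S2" using fin S(1) by auto
  define n :: "'i \<Rightarrow> real^2" where "n = (\<lambda>i. if i \<in> S1 then axis 1 1 else axis 2 1)"
  have "indep_family S (\<lambda>i. tensor (n i) (a i))"
    unfolding indep_family_def
  proof (intro allI impI)
    fix c assume "(\<Sum>i\<in>S. c i *\<^sub>R tensor (n i) (a i)) = 0"
    then have ev: "(\<Sum>i\<in>S. c i * (n i $ k * a i x)) = 0" for x k
      by (simp add: fun_eq_iff sum_fun_apply tensor_def)
    have split: "(\<Sum>i\<in>S. c i * (n i $ k * a i x))
      = (\<Sum>i\<in>S1. c i * (n i $ k * a i x)) + (\<Sum>i\<in>S2. c i * (n i $ k * a i x))" for x k
      using S(1,2) finS sum.union_disjoint by blast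
    have n2: "n i = axis 2 1" if "i \<in> S2" for i using that S(2) by (auto simp: n_def)
    have "(\<Sum>i\<in>S1. c i *\<^sub>R a i) x = 0" for x
      using ev[of 1 x] unfolding split by (simp add: sum_fun_apply n2 axis_def) (simp add: n_def axis_def)
    then have "(\<Sum>i\<in>S1. c i *\<^sub>R a i) = 0" by (simp add: fun_eq_iff)
    then have "\<forall>i\<in>S1. c i = 0" using S(3) unfolding indep_family_def by blast
    moreover have "(\<Sum>i\<in>S2. c i *\<^sub>R a i) x = 0" for x
      using ev[of 2 x] unfolding split by (simp add: sum_fun_apply n2 axis_def) (simp add: n_def axis_def)
    then have "(\<Sum>i\<in>S2. c i *\<^sub>R a i) = 0" by (simp add: fun_eq_iff)
    then have "\<forall>i\<in>S2. c i = 0" using S(4) unfolding indep_family_def by blast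
    ultimately show "\<forall>i\<in>S. c i = 0" using S(1) by blast
  qed
  then show ?thesis by blast
qed

section \<open>Genericity along lines\<close>

text \<open>A stand-in for Zariski openness that needs no topology and applies to any affine set
  \<open>U\<close>, in particular to the solution space of a linear system. The parameter 0 gives
  the good point \<open>q\<close>.\<close>

definition line_generic :: "'z::real_vector set \<Rightarrow> ('z \<Rightarrow> bool) \<Rightarrow> bool" where
  "line_generic U P \<longleftrightarrow> (\<forall>q\<in>U. \<forall>r\<in>U. P q \<longrightarrow> finite {t::real. \<not> P (q + t *\<^sub>R (r - q))})"

lemma line_generic_conj:
  assumes "line_generic U P" "line_generic U Q"
  shows "line_generic U (\<lambda>z. P z \<and> Q z)"
  unfolding line_generic_def
proof (intro ballI impI)
  fix q r assume "q \<in> U" "r \<in> U" "P q \<and> Q q"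
  then have "finite ({t. \<not> P (q + t *\<^sub>R (r - q))} \<union> {t. \<not> Q (q + t *\<^sub>R (r - q))})"
    using assms unfolding line_generic_def by simp
  then show "finite {t. \<not> (P (q + t *\<^sub>R (r - q)) \<and> Q (q + t *\<^sub>R (r - q)))}"
    by (rule finite_subset[rotated]) blast
qed

text \<open>On the line through a witness of \<open>P\<close> and a witness of \<open>Q\<close> each
  property fails at finitely many parameters only.\<close>

lemma line_generic_ex_conj:
  assumes U: "\<And>q r t. q \<in> U \<Longrightarrow> r \<in> U \<Longrightarrow> q + t *\<^sub>R (r - q) \<in> U"
    and P: "line_generic U P" "q \<in> U" "P q" and Q: "line_generic U Q" "r \<in> U" "Q r"
  shows "\<exists>z\<in>U. P z \<and> Q z"
proof -
  have "finite {t::real. \<not> P (q + t *\<^sub>R (r - q))}"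
    using P Q(2) unfolding line_generic_def by blast
  moreover have "finite {t::real. \<not> Q (q + t *\<^sub>R (r - q))}"
  proof -
    have "finite {t::real. \<not> Q (r + t *\<^sub>R (q - r))}" using Q P(2) unfolding line_generic_def by blast
    then have "finite ((\<lambda>t. 1 - t) ` {t::real. \<not> Q (r + t *\<^sub>R (q - r))})" by simp
    \<comment> \<open>The same line, run through from \<open>r\<close> to \<open>q\<close>, has
      parameter \<open>1 - t\<close>.\<close>
    moreover have "{t::real. \<not> Q (q + t *\<^sub>R (r - q))} \<subseteq> (\<lambda>t. 1 - t) ` {t::real. \<not> Q (r + t *\<^sub>R (q - r))}"
    proof
      fix t assume "t \<in> {t::real. \<not> Q (q + t *\<^sub>R (r - q))}"
      moreover have "r + (1 - t) *\<^sub>R (q - r) = q + t *\<^sub>R (r - q)" by (simp add: algebra_simps)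
      ultimately show "t \<in> (\<lambda>t. 1 - t) ` {t::real. \<not> Q (r + t *\<^sub>R (q - r))}"
        by (intro image_eqI[of _ _ "1 - t"]) auto
    qed
    ultimately show ?thesis by (rule finite_subset[rotated])
  qed
  ultimately have "finite ({t::real. \<not> P (q + t *\<^sub>R (r - q))} \<union> {t::real. \<not> Q (q + t *\<^sub>R (r - q))})"
    by simp
  then obtain t :: real where "t \<notin> {t. \<not> P (q + t *\<^sub>R (r - q))} \<union> {t. \<not> Q (q + t *\<^sub>R (r - q))}"
    using ex_new_if_finite infinite_UNIV_char_0 by blast
  then show ?thesis using U[OF P(2) Q(2), of t] by blast
qed

lemma line_generic_ex_Ball:
  assumes U: "\<And>q r t. q \<in> U \<Longrightarrow> r \<in> U \<Longrightarrow> q + t *\<^sub>R (r - q) \<in> U" and ne: "U \<noteq> {}"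
    and "finite K" and "\<And>k. k \<in> K \<Longrightarrow> line_generic U (P k)" and "\<And>k. k \<in> K \<Longrightarrow> \<exists>q\<in>U. P k q"
  shows "\<exists>z\<in>U. \<forall>k\<in>K. P k z"
proof -
  from assms(3-5) have "line_generic U (\<lambda>z. \<forall>k\<in>K. P k z) \<and> (\<exists>z\<in>U. \<forall>k\<in>K. P k z)"
  proof (induction K rule: finite_induct)
    case empty
    then show ?case using ne by (auto simp: line_generic_def)
  next
    case (insert k K)
    then have K: "line_generic U (\<lambda>z. \<forall>k\<in>K. P k z)" "\<exists>z\<in>U. \<forall>k\<in>K. P k z" by auto
    have k: "line_generic U (P k)" "\<exists>q\<in>U. P k q" using insert.prems by auto
    have eq: "(\<lambda>z. \<forall>k\<in>insert k K. P k z) = (\<lambda>z. P k z \<and> (\<forall>k\<in>K. P k z))" by auto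
    show ?case unfolding eq
      using line_generic_conj[OF k(1) K(1)] k K line_generic_ex_conj[OF U k(1) _ _ K(1)] by blast
  qed
  then show ?thesis by blast
qed

section \<open>Signed incidence functions and generic realizations\<close>

no_notation Matrix.scalar_prod (infix "\<bullet>" 70)
no_notation Matrix.vec_index (infixl "$" 100)

definition point_fun :: "'x \<Rightarrow> 'x \<Rightarrow> real" where
  "point_fun x = (\<lambda>y. if y = x then 1 else 0)"

text \<open>A row of the incidence matrix of a signed graph. A loop of sign 1 gives zero, a loop of
  sign -1 twice a point function.\<close>

definition incidence_fun :: "real \<Rightarrow> 'x \<Rightarrow> 'x \<Rightarrow> 'x \<Rightarrow> real" where
  "incidence_fun \<eta> x y = point_fun x - \<eta> *\<^sub>R point_fun y"

lemma indep_family_point_fun: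
  assumes "finite W" shows "indep_family W point_fun"
  unfolding indep_family_def
proof (intro allI impI ballI)
  fix c :: "'a \<Rightarrow> real" and x assume c: "(\<Sum>i\<in>W. c i *\<^sub>R point_fun i) = 0" and x: "x \<in> W"
  have "(\<Sum>i\<in>W. c i *\<^sub>R point_fun i) x = (\<Sum>i\<in>W. if i = x then c i else 0)"
    unfolding sum_fun_apply by (rule sum.cong) (auto simp: point_fun_def)
  also have "\<dots> = c x" using assms x by simp
  finally show "c x = 0" using c by simp
qed

lemma dim_superadditive_disjoint_support:
  fixes a :: "'i \<Rightarrow> 'x \<Rightarrow> real"
  assumes "finite F1" "finite F2" "F1 \<inter> F2 = {}"
    and s1: "\<And>i x. i \<in> F1 \<Longrightarrow> x \<notin> C \<Longrightarrow> a i x = 0"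
    and s2: "\<And>i x. i \<in> F2 \<Longrightarrow> x \<in> C \<Longrightarrow> a i x = 0"
  shows "dim (a ` F1) + dim (a ` F2) \<le> dim (a ` (F1 \<union> F2))"
proof -
  obtain J1 where J1: "J1 \<subseteq> F1" "indep_family J1 a" "card J1 = dim (a ` F1)"
    using obtain_indep_subfamily[OF assms(1)] by metis
  obtain J2 where J2: "J2 \<subseteq> F2" "indep_family J2 a" "card J2 = dim (a ` F2)"
    using obtain_indep_subfamily[OF assms(2)] by metis
  have fin: "finite J1" "finite J2" using J1 J2 assms(1,2) finite_subset by metis+
  have dj: "J1 \<inter> J2 = {}" using J1(1) J2(1) assms(3) by blast
  have "indep_family (J1 \<union> J2) a" unfolding indep_family_def
  proof (intro allI impI)
    fix c assume "(\<Sum>i\<in>J1 \<union> J2. c i *\<^sub>R a i) = 0"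
    then have e: "(\<Sum>i\<in>J1. c i *\<^sub>R a i) + (\<Sum>i\<in>J2. c i *\<^sub>R a i) = 0"
      using sum.union_disjoint[OF fin dj] by metis
    have z2: "(\<Sum>i\<in>J2. c i *\<^sub>R a i) x = 0" if "x \<in> C" for x
      unfolding sum_fun_apply by (rule sum.neutral) (use s2 J2(1) that in auto)
    have z1: "(\<Sum>i\<in>J1. c i *\<^sub>R a i) x = 0" if "x \<notin> C" for x
      unfolding sum_fun_apply by (rule sum.neutral) (use s1 J1(1) that in auto)
    have "(\<Sum>i\<in>J1. c i *\<^sub>R a i) x = 0" for x
      using fun_cong[OF e, of x] z1 z2 by (cases "x \<in> C") auto
    then have e1: "(\<Sum>i\<in>J1. c i *\<^sub>R a i) = 0" by (simp add: fun_eq_iff)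
    with e have e2: "(\<Sum>i\<in>J2. c i *\<^sub>R a i) = 0" by simp
    show "\<forall>i\<in>J1 \<union> J2. c i = 0"
      using e1 e2 J1(2) J2(2) unfolding indep_family_def by blast
  qed
  then have "card (J1 \<union> J2) \<le> dim (a ` (F1 \<union> F2))"
    by (rule indep_family_card_le_dim[rotated])
      (use fin assms(1,2) J1(1) J2(1) in \<open>auto intro!: span_base\<close>)
  then show ?thesis using card_Un_disjoint[OF fin dj] J1(3) J2(3) by simp
qed

text \<open>Switching by \<open>s\<close> makes all signs \<open>\<eta>\<close> on \<open>F\<close> trivial.\<close>
definition has_potential :: "('e \<Rightarrow> 'x) \<Rightarrow> ('e \<Rightarrow> 'x) \<Rightarrow> ('e \<Rightarrow> real) \<Rightarrow> 'e set \<Rightarrow> bool" where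
  "has_potential t h \<eta> F \<longleftrightarrow>
    (\<exists>s :: 'x \<Rightarrow> real. (\<forall>x. s x \<in> {1, -1}) \<and> (\<forall>e\<in>F. s (t e) = \<eta> e * s (h e)))"

text \<open>In the matroid of a signed graph, a connected component with vertex set W has rank |W| -
  1 if it has a potential and |W| otherwise; this is where the difference 2 between the two bounds
  goes. Ranks of vertex-disjoint pieces add up, and so do the bounds, since \<open>k\<close> is
  nonnegative. Signed incidence uses \<open>k = 1\<close>, unsigned incidence
  \<open>k = 0\<close>.\<close>

lemma card_le_incidence_dim:
  fixes t h :: "'e \<Rightarrow> 'x" and \<eta> :: "'e \<Rightarrow> real"
  assumes "finite F" "F \<noteq> {}" and \<eta>: "\<And>e. e \<in> F \<Longrightarrow> \<eta> e \<in> {1, -1}"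
    and "\<And>F'. F' \<subseteq> F \<Longrightarrow> F' \<noteq> {} \<Longrightarrow> has_potential t h \<eta> F' \<Longrightarrow>
          card F' + k + 2 \<le> 2 * card (t ` F' \<union> h ` F')"
    and "\<And>F'. F' \<subseteq> F \<Longrightarrow> F' \<noteq> {} \<Longrightarrow> card F' + k \<le> 2 * card (t ` F' \<union> h ` F')"
  shows "card F + k \<le> 2 * dim ((\<lambda>e. incidence_fun (\<eta> e) (t e) (h e)) ` F)"
  using assms
proof (induction "card F" arbitrary: F rule: less_induct)
  case less
  note fin = less.prems(1) and \<eta> = less.prems(3) and bal = less.prems(4) and unbal = less.prems(5)
  define a where "a = (\<lambda>e. incidence_fun (\<eta> e) (t e) (h e))"
  obtain e0 where e0: "e0 \<in> F" using less.prems(2) by blast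
  define v0 where "v0 = t e0"
  define T where "T = span (a ` F)"
  have subT: "Real_Vector_Spaces.subspace T" by (simp add: T_def)
  \<comment> \<open>\<open>C\<close> replaces the connected component of \<open>v0\<close>. It may
    also contain other components without a potential, which is harmless: what matters is that no
    edge of \<open>F\<close> leaves it and that its point functions agree with that of
    \<open>v0\<close> modulo \<open>T\<close> up to sign.\<close>
  define C where "C = {v. \<exists>s\<in>{1,-1::real}. point_fun v - s *\<^sub>R point_fun v0 \<in> T}"
  have aT: "point_fun (t e) - \<eta> e *\<^sub>R point_fun (h e) \<in> T" if "e \<in> F" for e
    using span_base[of "a e" "a ` F"] that by (simp add: T_def a_def incidence_fun_def)
  have v0C: "v0 \<in> C" unfolding C_def using subspace_0[OF subT] by force
  have th: "t e \<in> C \<longleftrightarrow> h e \<in> C" if e: "e \<in> F" for e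
  proof
    assume "t e \<in> C"
    then obtain s where s: "s \<in> {1,-1::real}" "point_fun (t e) - s *\<^sub>R point_fun v0 \<in> T"
      unfolding C_def by blast
    have "\<eta> e *\<^sub>R ((point_fun (t e) - s *\<^sub>R point_fun v0) - (point_fun (t e) - \<eta> e *\<^sub>R point_fun (h e))) \<in> T"
      by (rule subspace_scale[OF subT subspace_diff[OF subT s(2) aT[OF e]]])
    moreover have "\<eta> e *\<^sub>R ((point_fun (t e) - s *\<^sub>R point_fun v0) - (point_fun (t e) - \<eta> e *\<^sub>R point_fun (h e)))
       = point_fun (h e) - (\<eta> e * s) *\<^sub>R point_fun v0"
      using \<eta>[OF e] by (auto simp: algebra_simps)
    moreover have "\<eta> e * s \<in> {1,-1}" using s(1) \<eta>[OF e] by auto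
    ultimately show "h e \<in> C" unfolding C_def by (metis (no_types, lifting) mem_Collect_eq)
  next
    assume "h e \<in> C"
    then obtain s where s: "s \<in> {1,-1::real}" "point_fun (h e) - s *\<^sub>R point_fun v0 \<in> T"
      unfolding C_def by blast
    have "\<eta> e *\<^sub>R (point_fun (h e) - s *\<^sub>R point_fun v0) + (point_fun (t e) - \<eta> e *\<^sub>R point_fun (h e)) \<in> T"
      by (rule subspace_add[OF subT subspace_scale[OF subT s(2)] aT[OF e]])
    moreover have "\<eta> e *\<^sub>R (point_fun (h e) - s *\<^sub>R point_fun v0) + (point_fun (t e) - \<eta> e *\<^sub>R point_fun (h e))
       = point_fun (t e) - (\<eta> e * s) *\<^sub>R point_fun v0"
      by (auto simp: algebra_simps)
    moreover have "\<eta> e * s \<in> {1,-1}" using s(1) \<eta>[OF e] by auto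
    ultimately show "t e \<in> C" unfolding C_def by (metis (no_types, lifting) mem_Collect_eq)
  qed
  define F1 where "F1 = {e \<in> F. t e \<in> C}"
  define F2 where "F2 = F - F1"
  show ?case unfolding a_def[symmetric]
  proof (cases "F2 = {}")
    case False
    have F12: "F1 \<union> F2 = F" "F1 \<inter> F2 = {}" "finite F1" "finite F2" "F1 \<noteq> {}"
      using fin e0 v0C by (auto simp: F1_def F2_def v0_def)
    have lt: "card F1 < card F" "card F2 < card F"
      using F12 False fin by (auto intro!: psubset_card_mono)
    have i1: "card F1 + k \<le> 2 * dim (a ` F1)"
      unfolding a_def using F12 by (intro less.hyps[OF lt(1)] \<eta> bal unbal) auto
    have i2: "card F2 + k \<le> 2 * dim (a ` F2)"
      unfolding a_def using F12 False by (intro less.hyps[OF lt(2)] \<eta> bal unbal) auto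
    have "dim (a ` F1) + dim (a ` F2) \<le> dim (a ` (F1 \<union> F2))"
    proof (rule dim_superadditive_disjoint_support)
      show "a i x = 0" if "i \<in> F1" "x \<notin> C" for i x
        using that th[of i] by (auto simp: F1_def a_def incidence_fun_def point_fun_def)
      show "a i x = 0" if "i \<in> F2" "x \<in> C" for i x
        using that th[of i] by (auto simp: F1_def F2_def a_def incidence_fun_def point_fun_def)
    qed (use F12 in auto)
    moreover have "card F = card F1 + card F2" using F12 card_Un_disjoint by metis
    ultimately show "card F + k \<le> 2 * dim (a ` F)" using i1 i2 F12(1) by simp
  next
    case True
    let ?W = "t ` F \<union> h ` F"
    have WC: "?W \<subseteq> C" using True th by (auto simp: F1_def F2_def)
    have finW: "finite ?W" using fin by simp
    have "\<forall>v\<in>C. \<exists>s. s \<in> {1,-1::real} \<and> point_fun v - s *\<^sub>R point_fun v0 \<in> T"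
      by (auto simp: C_def)
    then obtain s where s: "\<And>v. v \<in> C \<Longrightarrow> s v \<in> {1,-1::real}"
      and sT: "\<And>v. v \<in> C \<Longrightarrow> point_fun v - s v *\<^sub>R point_fun v0 \<in> T"
      by metis
    obtain B where B: "B \<subseteq> a ` F" "a ` F \<subseteq> span B" "card B = dim (a ` F)"
      using ex_basis_subset by metis
    have finB: "finite B" using B(1) fin finite_subset by blast
    have TB: "T \<subseteq> span B" using B(2) unfolding T_def by (simp add: span_minimal)
    show "card F + k \<le> 2 * dim (a ` F)"
    \<comment> \<open>If the signs \<open>s\<close> form a potential, one additional vector, the
      point function of \<open>v0\<close>, completes \<open>B\<close> to a spanning set of all
      vertices.\<close>
    proof (cases "\<forall>e\<in>F. s (t e) = \<eta> e * s (h e)")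
      case True
      define s' where "s' = (\<lambda>v. if v \<in> C then s v else 1)"
      have "has_potential t h \<eta> F" unfolding has_potential_def
        by (rule exI[of _ s']) (use s True WC in \<open>auto simp: s'_def\<close>)
      then have "card F + k + 2 \<le> 2 * card ?W" using bal[of F] less.prems(2) by blast
      moreover have "card ?W \<le> card (insert (point_fun v0) B)"
      proof (rule indep_family_card_le[OF finW indep_family_point_fun[OF finW]])
        have "point_fun v \<in> span (insert (point_fun v0) B)" if "v \<in> ?W" for v
        proof -
          have "point_fun v - s v *\<^sub>R point_fun v0 \<in> span B" using sT that WC TB by blast
          then show ?thesis using span_breakdown_eq[of "point_fun v" "point_fun v0" B] by blast
        qed
        then show "point_fun ` ?W \<subseteq> span (insert (point_fun v0) B)" by blast
      qed (use finB in simp)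
      moreover have "card (insert (point_fun v0) B) \<le> dim (a ` F) + 1"
        using B(3) finB by (simp add: card_insert_if)
      ultimately show ?thesis by linarith
    next
      case False
      \<comment> \<open>An edge incompatible with \<open>s\<close> compares two different multiples
        of the point function of \<open>v0\<close> modulo \<open>T\<close>, which puts it and hence
        all vertices into \<open>T\<close>.\<close>
      then obtain e where e: "e \<in> F" "s (t e) \<noteq> \<eta> e * s (h e)" by blast
      have C: "t e \<in> C" "h e \<in> C" using e(1) WC by auto
      have "(point_fun (t e) - \<eta> e *\<^sub>R point_fun (h e)) - (point_fun (t e) - s (t e) *\<^sub>R point_fun v0)
         + \<eta> e *\<^sub>R (point_fun (h e) - s (h e) *\<^sub>R point_fun v0) \<in> T"
        by (rule subspace_add[OF subT subspace_diff[OF subT aT[OF e(1)] sT[OF C(1)]]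
            subspace_scale[OF subT sT[OF C(2)]]])
      then have "(s (t e) - \<eta> e * s (h e)) *\<^sub>R point_fun v0 \<in> T" by (simp add: algebra_simps)
      from subspace_scale[OF subT this, of "1 / (s (t e) - \<eta> e * s (h e))"] e(2)
      have v0T: "point_fun v0 \<in> T" by simp
      have "point_fun v \<in> T" if "v \<in> ?W" for v
      proof -
        have "point_fun v - s v *\<^sub>R point_fun v0 \<in> T" using sT that WC by blast
        from subspace_add[OF subT this subspace_scale[OF subT v0T, of "s v"]] show ?thesis by simp
      qed
      then have "card ?W \<le> card B"
        using indep_family_card_le[OF finW indep_family_point_fun[OF finW] finB] TB by blast
      moreover have "card F + k \<le> 2 * card ?W" using unbal[of F] less.prems(2) by blast
      ultimately show ?thesis using B(3) by linarith
    qed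
  qed
qed

section \<open>Placements with prescribed edge directions\<close>

text \<open>The quarter turn serves twice: it turns a prescribed normal into an edge direction, and
  it gives the velocities of an infinitesimal rotation about the origin.\<close>

definition rot90 :: "real^2 \<Rightarrow> real^2" where
  "rot90 v = (\<chi> k. if k = 1 then - v $ 2 else v $ 1)"

lemma rot90_nth [simp]: "rot90 v $ 1 = - v $ 2" "rot90 v $ 2 = v $ 1"
  by (simp_all add: rot90_def)

lemma inner_real_2: "(x :: real^2) \<bullet> y = x $ 1 * y $ 1 + x $ 2 * y $ 2"
  by (simp add: inner_vec_def sum_2)

lemma orthogonal_eq_scaled_rot90:
  assumes "n \<bullet> d = 0" "n \<noteq> 0"
  obtains c where "d = c *\<^sub>R rot90 n"
proof -
  have nz: "n \<bullet> n \<noteq> 0" using assms(2) by simp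
  have o: "n $ 1 * d $ 1 = - (n $ 2 * d $ 2)" using assms(1) by (simp add: inner_real_2)
  \<comment> \<open>The coefficient is the determinant of \<open>n\<close> and
    \<open>d\<close>.\<close>
  have "(n \<bullet> n) *\<^sub>R d = (n $ 1 * d $ 2 - n $ 2 * d $ 1) *\<^sub>R rot90 n"
  proof -
    have "(n $ 1 * n $ 1 + n $ 2 * n $ 2) * d $ 1 = (n $ 1 * d $ 2 - n $ 2 * d $ 1) * (- n $ 2)"
      using arg_cong[OF o, of "\<lambda>z. n $ 1 * z"] by (simp add: algebra_simps)
    moreover have "(n $ 1 * n $ 1 + n $ 2 * n $ 2) * d $ 2 = (n $ 1 * d $ 2 - n $ 2 * d $ 1) * n $ 1"
      using arg_cong[OF o, of "\<lambda>z. n $ 2 * z"] by (simp add: algebra_simps)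
    ultimately show ?thesis by (simp add: Finite_Cartesian_Product.vec_eq_iff forall_2 inner_real_2)
  qed
  then have "d = ((n $ 1 * d $ 2 - n $ 2 * d $ 1) / (n \<bullet> n)) *\<^sub>R rot90 n"
    using nz by (metis (no_types, opaque_lifting) divide_inverse_commute inverse_eq_divide left_inverse scaleR_one scaleR_scaleR)
  then show thesis by (rule that)
qed

text \<open>Entries that are affine in the placement become polynomials of degree at most one along
  a line.\<close>

lemma line_generic_indep_family:
  fixes w :: "'z::real_vector \<Rightarrow> 'i \<Rightarrow> 'c \<Rightarrow> real"
  assumes "finite I"
    and aff: "\<And>q r t i j. i \<in> I \<Longrightarrow> w (q + t *\<^sub>R (r - q)) i j = w q i j + t * (w r i j - w q i j)"
  shows "line_generic U (\<lambda>z. indep_family I (w z))"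
  unfolding line_generic_def
proof (intro ballI impI)
  fix q r assume q: "indep_family I (w q)"
  define P where "P = (\<lambda>i j. [:w q i j, w r i j - w q i j:])"
  have eq: "indep_family I (w (q + t *\<^sub>R (r - q))) \<longleftrightarrow> indep_family I (\<lambda>i j. poly (P i j) t)" for t
  proof -
    have "w (q + t *\<^sub>R (r - q)) i = (\<lambda>j. poly (P i j) t)" if "i \<in> I" for i
      using aff[OF that] by (simp add: P_def fun_eq_iff)
    then show ?thesis unfolding indep_family_def by simp
  qed
  have "indep_family I (\<lambda>i j. poly (P i j) 0)" using q eq[of 0] by simp
  from finite_dependent_parameters[OF assms(1) this]
  show "finite {t. \<not> indep_family I (w (q + t *\<^sub>R (r - q)))}" unfolding eq .
qed

lemma line_generic_nonzero:
  fixes D :: "'z::real_vector \<Rightarrow> real^2"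
  assumes aff: "\<And>q r t. D (q + t *\<^sub>R (r - q)) = D q + t *\<^sub>R (D r - D q)"
  shows "line_generic U (\<lambda>z. D z \<noteq> 0)"
  unfolding line_generic_def
proof (intro ballI impI)
  fix q r assume "D q \<noteq> 0"
  then obtain k where k: "D q $ k \<noteq> 0" by (auto simp: Finite_Cartesian_Product.vec_eq_iff)
  have "{t. \<not> D (q + t *\<^sub>R (r - q)) \<noteq> 0} \<subseteq> {t. poly [:D q $ k, D r $ k - D q $ k:] t = 0}"
  proof
    fix t assume "t \<in> {t. \<not> D (q + t *\<^sub>R (r - q)) \<noteq> 0}"
    then have "(D q + t *\<^sub>R (D r - D q)) $ k = 0" unfolding aff by simp
    then show "t \<in> {t. poly [:D q $ k, D r $ k - D q $ k:] t = 0}" by simp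
  qed
  moreover have "finite {t. poly [:D q $ k, D r $ k - D q $ k:] t = 0}"
    using k by (intro poly_roots_finite) auto
  ultimately show "finite {t. \<not> D (q + t *\<^sub>R (r - q)) \<noteq> 0}" by (rule finite_subset)
qed

lemma tensor_scaleR: "tensor (c *\<^sub>R d) a = c *\<^sub>R tensor d a"
  by (simp add: tensor_def fun_eq_iff)

lemma indep_family_scaleR:
  assumes "\<And>i. i \<in> I \<Longrightarrow> c i \<noteq> 0" "indep_family I w"
  shows "indep_family I (\<lambda>i. c i *\<^sub>R w i)"
  unfolding indep_family_def
proof (intro allI impI ballI)
  fix d i assume "(\<Sum>i\<in>I. d i *\<^sub>R (c i *\<^sub>R w i)) = 0" and i: "i \<in> I"
  then have "(\<Sum>i\<in>I. (d i * c i) *\<^sub>R w i) = 0" by simp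
  from indep_familyD[OF assms(2) this i] show "d i = 0" using assms(1)[OF i] by simp
qed

text \<open>Read in two ways: as a linear equation for an unknown placement with given normals, and
  as the pairing of a row with an infinitesimal motion.\<close>

lemma sum_tensor_incidence:
  fixes p :: "'x \<Rightarrow> real^2"
  assumes "finite W" "u \<in> W" "v \<in> W"
  shows "(\<Sum>j\<in>W \<times> UNIV. tensor d (incidence_fun \<eta> u v) j * p (fst j) $ snd j) = d \<bullet> (p u - \<eta> *\<^sub>R p v)"
proof -
  have pt: "(\<Sum>x\<in>W. point_fun y x * (d \<bullet> p x)) = d \<bullet> p y" if "y \<in> W" for y
  proof -
    have "(\<Sum>x\<in>W. point_fun y x * (d \<bullet> p x)) = (\<Sum>x\<in>W. if x = y then d \<bullet> p x else 0)"
      by (rule sum.cong) (auto simp: point_fun_def)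
    then show ?thesis using assms(1) that by simp
  qed
  have "(\<Sum>j\<in>W \<times> UNIV. tensor d (incidence_fun \<eta> u v) j * p (fst j) $ snd j)
      = (\<Sum>(x, k)\<in>W \<times> UNIV. tensor d (incidence_fun \<eta> u v) (x, k) * p x $ k)"
    by (rule sum.cong) auto
  also have "\<dots> = (\<Sum>x\<in>W. incidence_fun \<eta> u v x * (d \<bullet> p x))"
    unfolding sum.cartesian_product[symmetric]
    by (rule sum.cong) (auto simp: tensor_def sum_2 inner_real_2 algebra_simps)
  also have "\<dots> = (\<Sum>x\<in>W. point_fun u x * (d \<bullet> p x)) - \<eta> * (\<Sum>x\<in>W. point_fun v x * (d \<bullet> p x))"
    by (simp add: incidence_fun_def algebra_simps sum_subtractf sum_distrib_left)
  also have "\<dots> = d \<bullet> (p u - \<eta> *\<^sub>R p v)"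
    using assms by (simp add: pt inner_diff_right)
  finally show ?thesis .
qed

lemma line_generic_tensor:
  assumes "finite I"
    and aff: "\<And>q r t i. i \<in> I \<Longrightarrow> D (q + t *\<^sub>R (r - q)) i = D q i + t *\<^sub>R (D r i - D q i)"
  shows "line_generic U (\<lambda>z::'z::real_vector. indep_family I (\<lambda>i. tensor (D z i) (c i)))"
  by (rule line_generic_indep_family[OF assms(1)])
    (simp add: aff tensor_def case_prod_unfold, simp add: algebra_simps)

text \<open>
  For generic directions \<open>n e\<close> the conditions \<open>n e \<bullet> (p (t e) - \<epsilon> e p (h e)) = 0\<close> remain independent after
  doubling one edge, so some solution \<open>p\<close> does not collapse that edge; a generic solution then
  collapses no edge and has edge vectors parallel to the rotated directions.
\<close>
lemma ex_realization_with_indep_rows: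
  fixes t h :: "'e \<Rightarrow> 'x" and \<epsilon> :: "'e \<Rightarrow> real" and b :: "'e \<Rightarrow> 'x \<Rightarrow> real"
  defines "a \<equiv> \<lambda>e. incidence_fun (\<epsilon> e) (t e) (h e)"
  assumes fin: "finite I"
    and hall_a: "\<And>F. F \<subseteq> I \<Longrightarrow> F \<noteq> {} \<Longrightarrow> card F + 1 \<le> 2 * dim (a ` F)"
    and hall_b: "\<And>F. F \<subseteq> I \<Longrightarrow> card F \<le> 2 * dim (b ` F)"
  shows "\<exists>p :: 'x \<Rightarrow> real^2. indep_family I (\<lambda>e. tensor (p (t e) - \<epsilon> e *\<^sub>R p (h e)) (b e))"
proof -
  define W where "W = t ` I \<union> h ` I"
  have finW: "finite W" using fin by (simp add: W_def)
  \<comment> \<open>\<open>None\<close> is the second copy of the edge that is doubled; each edge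
    \<open>e\<close> has its own doubled family \<open>a' e\<close>.\<close>
  let ?K = "insert None (Some ` I)"
  define a' where "a' = (\<lambda>e i. a (case i of None \<Rightarrow> e | Some f \<Rightarrow> f))"
  \<comment> \<open>Here the index \<open>None\<close> has another role: it stands for independence
    of the desired rows, while \<open>Some e\<close> stands for the system with \<open>e\<close>
    doubled.\<close>
  define P where "P = (\<lambda>i n :: 'e option \<Rightarrow> real^2. case i of
      None \<Rightarrow> indep_family I (\<lambda>f. tensor (rot90 (n (Some f))) (b f))
    | Some e \<Rightarrow> indep_family ?K (\<lambda>i. tensor (n i) (a' e i)))"
  have rot_aff: "rot90 (x + s *\<^sub>R (y - x)) = rot90 x + s *\<^sub>R (rot90 y - rot90 x)" for x y s
    by (simp add: Finite_Cartesian_Product.vec_eq_iff forall_2 algebra_simps)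
  have "\<exists>n\<in>UNIV. \<forall>i\<in>?K. P i n"
  proof (rule line_generic_ex_Ball)
    show "line_generic UNIV (P i)" if "i \<in> ?K" for i
      using fin by (cases i) (auto simp: P_def rot_aff intro!: line_generic_tensor)
    show "\<exists>n\<in>UNIV. P i n" if i: "i \<in> ?K" for i
    proof (cases i)
      case None
      \<comment> \<open>The desired rows contain rotated normals, so the normals are chosen as the
        inverse quarter turns of the independent directions \<open>m\<close>.\<close>
      obtain m :: "'e \<Rightarrow> real^2" where m: "indep_family I (\<lambda>i. tensor (m i) (b i))"
        using ex_indep_tensor_directions[OF fin hall_b] by blast
      have "rot90 (- rot90 x) = x" for x
        by (simp add: Finite_Cartesian_Product.vec_eq_iff forall_2)
      with m have "P None (\<lambda>i. - rot90 (m (the i)))" by (simp add: P_def)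
      with None show ?thesis by blast
    next
      case (Some e)
      then have e: "e \<in> I" using i by blast
      have "\<exists>n :: 'e option \<Rightarrow> real^2. indep_family ?K (\<lambda>i. tensor (n i) (a' e i))"
      proof (rule ex_indep_tensor_directions)
        fix F assume F: "F \<subseteq> ?K"
        define F' where "F' = {f. Some f \<in> F}"
        have F': "F' \<subseteq> I" using F by (auto simp: F'_def)
        have finF: "finite F'" "finite F"
          using finite_subset[OF F' fin] finite_subset[OF F] fin by auto
        have img: "a ` F' \<subseteq> a' e ` F" by (force simp: F'_def a'_def)
        \<comment> \<open>The extra copy adds at most one element, the unit reserved in
          \<open>hall_a\<close>.\<close>
        have "card F \<le> card F' + 1"
        proof -
          have "F \<subseteq> insert None (Some ` F')" 
          proof
            fix i assume "i \<in> F"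
            then show "i \<in> insert None (Some ` F')" by (cases i) (auto simp: F'_def)
          qed
          then have "card F \<le> card (insert None (Some ` F'))" using finF by (intro card_mono) auto
          then show ?thesis using finF by (simp add: card_image)
        qed
        show "card F \<le> 2 * dim (a' e ` F)"
        proof (cases "F' = {}")
          case False
          have "card F' + 1 \<le> 2 * dim (a ` F')" using hall_a[OF F' False] .
          moreover have "dim (a ` F') \<le> dim (a' e ` F)" using img finF by (intro dim_mono_finite) auto
          ultimately show ?thesis using \<open>card F \<le> card F' + 1\<close> by linarith
        next
          case True
          show ?thesis
          proof (cases "None \<in> F")
            case False
            then have "F = {}" using True F by (auto simp: F'_def)
            then show ?thesis by simp
          next
            case N: True
            have "a ` {e} \<subseteq> a' e ` F" using N by (force simp: a'_def)
            then have "dim (a ` {e}) \<le> dim (a' e ` F)" using finF by (intro dim_mono_finite) auto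
            moreover have "card {e} + 1 \<le> 2 * dim (a ` {e})" using e by (intro hall_a) auto
            ultimately show ?thesis using \<open>card F \<le> card F' + 1\<close> True by simp
          qed
        qed
      qed (use fin in simp)
      with Some show ?thesis by (simp add: P_def)
    qed
  qed (use fin in auto)
  then obtain n where n: "\<And>i. i \<in> ?K \<Longrightarrow> P i n" by blast
  have indb: "indep_family I (\<lambda>f. tensor (rot90 (n (Some f))) (b f))"
    using n[of None] by (simp add: P_def)
  have inda: "indep_family ?K (\<lambda>i. tensor (n i) (a' e i))" if "e \<in> I" for e
    using n[of "Some e"] that by (simp add: P_def)
  define D where "D = (\<lambda>e (p :: 'x \<Rightarrow> real^2). p (t e) - \<epsilon> e *\<^sub>R p (h e))"
  have D_aff: "D e (q + s *\<^sub>R (r - q)) = D e q + s *\<^sub>R (D e r - D e q)" for e q r s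
    by (simp add: D_def algebra_simps)
  define U where "U = {p. \<forall>f\<in>I. n (Some f) \<bullet> D f p = 0}"
  have "\<exists>p\<in>U. \<forall>e\<in>I. D e p \<noteq> 0"
  proof (rule line_generic_ex_Ball)
    show "q + s *\<^sub>R (r - q) \<in> U" if "q \<in> U" "r \<in> U" for q r s
      using that by (simp add: U_def D_aff inner_add_right inner_diff_right)
    have "0 \<in> U" by (simp add: U_def D_def)
    then show "U \<noteq> {}" by blast
    show "line_generic U (\<lambda>p. D e p \<noteq> 0)" for e
      by (rule line_generic_nonzero) (rule D_aff)
    show "\<exists>p\<in>U. D e p \<noteq> 0" if e: "e \<in> I" for e
    proof -
      have ends: "t (case i of None \<Rightarrow> e | Some f \<Rightarrow> f) \<in> W" "h (case i of None \<Rightarrow> e | Some f \<Rightarrow> f) \<in> W"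
        if "i \<in> ?K" for i
        using that e by (auto simp: W_def)
      \<comment> \<open>The equations of all original edges are homogeneous, so the solution lies in
        \<open>U\<close>; the extra copy of \<open>e\<close> receives the value 1, which prevents
        \<open>e\<close> from collapsing.\<close>
      have "\<exists>x. \<forall>i\<in>?K. (\<Sum>j\<in>W \<times> UNIV. tensor (n i) (a' e i) j * x j) = (if i = None then 1 else 0)"
      proof (rule indep_family_solvable[OF _ _ inda[OF e]])
        show "tensor (n i) (a' e i) j = 0" if "i \<in> ?K" "j \<notin> W \<times> UNIV" for i j
          using ends[OF that(1)] that(2)
          by (cases j) (auto simp: tensor_def a'_def a_def incidence_fun_def point_fun_def)
      qed (use fin finW in auto)
      then obtain x where x: "\<And>i. i \<in> ?K \<Longrightarrow>
          (\<Sum>j\<in>W \<times> UNIV. tensor (n i) (a' e i) j * x j) = (if i = None then 1 else 0)"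
        by blast
      define p :: "'x \<Rightarrow> real^2" where "p = (\<lambda>v. \<chi> k. x (v, k))"
      have xp: "x j = p (fst j) $ snd j" for j by (simp add: p_def)
      have np: "n i \<bullet> D (case i of None \<Rightarrow> e | Some f \<Rightarrow> f) p = (if i = None then 1 else 0)"
        if "i \<in> ?K" for i
        using x[OF that] sum_tensor_incidence[OF finW ends[OF that]]
        by (simp add: xp a'_def a_def D_def)
      have "p \<in> U" using np[of "Some _"] by (simp add: U_def)
      moreover have "D e p \<noteq> 0" using np[of None] by auto
      ultimately show ?thesis by blast
    qed
  qed (use fin in auto)
  then obtain p where p: "p \<in> U" "\<And>e. e \<in> I \<Longrightarrow> D e p \<noteq> 0" by blast
  have "\<exists>c. c \<noteq> 0 \<and> D e p = c *\<^sub>R rot90 (n (Some e))" if e: "e \<in> I" for e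
  proof -
    \<comment> \<open>An independent family has no zero row, so the normal is nonzero, and
      orthogonality to it in the plane leaves only multiples of its quarter turn.\<close>
    have "tensor (n (Some e)) (a' e (Some e)) \<noteq> 0"
      using indep_family_nonzero[OF _ inda[OF e], of "Some e"] fin e by (metis (no_types, lifting) finite.insertI finite_imageI imageI insertI2 zero_fun_apply)
    then have "n (Some e) \<noteq> 0" by (auto simp: tensor_def fun_eq_iff)
    then obtain c where "D e p = c *\<^sub>R rot90 (n (Some e))"
      using orthogonal_eq_scaled_rot90[of "n (Some e)" "D e p"] p(1) e by (auto simp: U_def)
    with p(2)[OF e] show ?thesis by (intro exI[of _ c]) auto
  qed
  then obtain c where c: "\<And>e. e \<in> I \<Longrightarrow> c e \<noteq> 0" "\<And>e. e \<in> I \<Longrightarrow> D e p = c e *\<^sub>R rot90 (n (Some e))"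
    by metis
  have "indep_family I (\<lambda>e. tensor (D e p) (b e)) \<longleftrightarrow>
      indep_family I (\<lambda>e. c e *\<^sub>R tensor (rot90 (n (Some e))) (b e))"
    unfolding indep_family_def by (simp add: c(2) tensor_scaleR)
  moreover have "indep_family I (\<lambda>e. c e *\<^sub>R tensor (rot90 (n (Some e))) (b e))"
    by (rule indep_family_scaleR) (use c(1) indb in auto)
  ultimately have "indep_family I (\<lambda>e. tensor (p (t e) - \<epsilon> e *\<^sub>R p (h e)) (b e))"
    by (simp add: D_def)
  then show ?thesis by blast
qed

section \<open>Balanced edge sets and the rank of the rigidity matrix\<close>

definition gain_sign :: "int \<Rightarrow> real" where
  "gain_sign x = (if x = 0 then 1 else -1)"

lemma gain_sign_cases: "gain_sign x \<in> {1, -1}"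
  by (simp add: gain_sign_def)

lemma gain_sign_square [simp]: "gain_sign x * gain_sign x = 1"
  by (simp add: gain_sign_def)

lemma carrier_integer_mod_group_2: "carrier (integer_mod_group 2) = {0, 1}"
  by (auto simp: carrier_integer_mod_group)

lemma gain_sign_mult:
  assumes "x \<in> {0, 1}" "y \<in> {0, 1}"
  shows "gain_sign ((x + y) mod 2) = gain_sign x * gain_sign y"
  using assms by (auto simp: gain_sign_def)

lemma gain_sign_eq_1_iff: "gain_sign x = 1 \<longleftrightarrow> x = 0"
  by (simp add: gain_sign_def)

text \<open>Each traversed edge contributes the product of the potentials at its two ends, in either
  direction because signs are self-inverse; along a walk these products telescope.\<close>

lemma walk_gain_potential:
  fixes H :: "('a, 'b) pre_digraph" and \<psi> :: "'b \<Rightarrow> int"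
  assumes "pre_digraph.cas (bidirect H) u c v"
    and "\<And>e. e \<in> fst ` set c \<Longrightarrow> \<psi> e \<in> {0, 1}"
    and "\<And>x. s x \<in> {1, -1}"
    and "\<And>e. e \<in> fst ` set c \<Longrightarrow> s (tail H e) = gain_sign (\<psi> e) * s (head H e)"
  shows "walk_gain (integer_mod_group 2) \<psi> c \<in> {0, 1}
    \<and> gain_sign (walk_gain (integer_mod_group 2) \<psi> c) = s u * s v"
  using assms
proof (induction c arbitrary: u)
  case Nil
  have "s v * s v = 1" using Nil.prems(3)[of v] by auto
  with Nil.prems(1) show ?case by (auto simp: pre_digraph.cas.simps walk_gain_def gain_sign_def)
next
  case (Cons eb c)
  obtain e b where eb: "eb = (e, b)" by force
  let ?y = "walk_gain (integer_mod_group 2) \<psi> c"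
  define w where "w = head (bidirect H) eb"
  have cas: "tail (bidirect H) eb = u" "pre_digraph.cas (bidirect H) w c v"
    using Cons.prems(1) by (simp_all add: pre_digraph.cas.simps w_def)
  have IH: "?y \<in> {0, 1}" "gain_sign ?y = s w * s v"
    using Cons.IH[OF cas(2)] Cons.prems by auto
  have e: "\<psi> e \<in> {0, 1}" "s (tail H e) = gain_sign (\<psi> e) * s (head H e)"
    using Cons.prems(2,4)[of e] eb by auto
  have uw: "s u = gain_sign (\<psi> e) * s w"
    using cas(1) e(2) gain_sign_square[of "\<psi> e"] unfolding w_def eb bidirect_def
    by (cases b) (auto simp: algebra_simps)
  have "inv\<^bsub>integer_mod_group 2\<^esub> \<psi> e = \<psi> e"
    using e(1) by (auto simp: carrier_integer_mod_group_2)
  then have wg: "walk_gain (integer_mod_group 2) \<psi> (eb # c) = (\<psi> e + ?y) mod 2"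
    by (simp add: walk_gain_def eb)
  show ?case unfolding wg using gain_sign_mult[OF e(1) IH(1)] IH(2) uw e(1) IH(1) by auto
qed

lemma wf_digraph_bidirect: "wf_digraph H \<Longrightarrow> wf_digraph (bidirect H)"
  by unfold_locales (auto simp: bidirect_def wf_digraph.tail_in_verts wf_digraph.head_in_verts)

text \<open>Traversing the first edge again, in either direction, would bring the path back to its
  starting vertex. This supplies the distinct underlying edges demanded by
  \<open>undirected_cycle\<close>.\<close>

lemma apath_bidirect_distinct_edges:
  assumes wf: "wf_digraph (bidirect H)" and "pre_digraph.apath (bidirect H) u p v"
  shows "distinct (map fst p)"
  using assms(2)
proof (induction p arbitrary: u)
  case Nil
  then show ?case by simp
next
  case (Cons eb p)
  interpret wf_digraph "bidirect H" by (rule wf)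
  obtain e b where eb: "eb = (e, b)" by force
  define w where "w = head (bidirect H) eb"
  have *: "tail (bidirect H) eb = u" "apath w p v" "u \<notin> set (awalk_verts w p)"
    using Cons.prems by (auto simp: apath_Cons_iff w_def)
  have "e \<notin> fst ` set p"
  proof
    assume "e \<in> fst ` set p"
    then obtain b' where b': "(e, b') \<in> set p" by force
    have "cas w p v" using *(2) by (auto simp: apath_def awalk_def)
    from set_awalk_verts_cas[OF this] b'
    have "tail (bidirect H) (e, b') \<in> set (awalk_verts w p)" "head (bidirect H) (e, b') \<in> set (awalk_verts w p)"
      by auto
    then have "tail H e \<in> set (awalk_verts w p)" "head H e \<in> set (awalk_verts w p)"
      by (auto simp: bidirect_def split: if_splits)
    moreover have "u = tail H e \<or> u = head H e" using *(1) by (auto simp: eb bidirect_def)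
    ultimately show False using *(3) by auto
  qed
  with Cons.IH[OF *(2)] show ?case by (simp add: eb)
qed

text \<open>Edges are added one at a time. A new edge either closes a cycle, whose trivial gain
  makes the old potential fit, or it meets two parts not connected by \<open>F\<close>, one of which
  can be switched.\<close>

lemma balanced_imp_has_potential:
  fixes H :: "('a, 'b) pre_digraph" and \<psi> :: "'b \<Rightarrow> int"
  assumes wf: "wf_digraph H" and "finite F" "F \<subseteq> arcs H"
    and \<psi>: "\<And>e. e \<in> arcs H \<Longrightarrow> \<psi> e \<in> {0, 1}"
    and "balanced (integer_mod_group 2) H \<psi> F"
  shows "has_potential (tail H) (head H) (\<lambda>e. gain_sign (\<psi> e)) F"
  using assms(2,3,5)
proof (induction F rule: finite_induct)
  case empty
  then show ?case by (auto simp: has_potential_def intro: exI[of _ "\<lambda>_. 1"])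
next
  case (insert e F)
  interpret B: wf_digraph "bidirect H" by (rule wf_digraph_bidirect[OF wf])
  have arcsB: "arcs (bidirect H) = arcs H \<times> UNIV" by (simp add: bidirect_def)
  have F: "F \<subseteq> arcs H" and e: "e \<in> arcs H" using insert.prems by auto
  have "balanced (integer_mod_group 2) H \<psi> F"
    using insert.prems(2) unfolding balanced_def by blast
  from insert.IH[OF F this] obtain s where s: "\<And>x. s x \<in> {1, -1::real}"
    and sF: "\<And>f. f \<in> F \<Longrightarrow> s (tail H f) = gain_sign (\<psi> f) * s (head H f)"
    unfolding has_potential_def by blast
  \<comment> \<open>The vertices connected to the head of the new edge by edges of
    \<open>F\<close>.\<close>
  define R where "R = {Z. \<exists>p. B.awalk (head H e) p Z \<and> fst ` set p \<subseteq> F}"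
  have step: "head (bidirect H) (f, b) \<in> R" if R: "tail (bidirect H) (f, b) \<in> R" and f: "f \<in> F" for f b
  proof -
    obtain p where p: "B.awalk (head H e) p (tail (bidirect H) (f, b))" "fst ` set p \<subseteq> F"
      using R unfolding R_def by blast
    have "B.awalk (tail (bidirect H) (f, b)) [(f, b)] (head (bidirect H) (f, b))"
      using f F arcsB by (intro B.arc_implies_awalk) auto
    from B.awalk_appendI[OF p(1) this]
    have "B.awalk (head H e) (p @ [(f, b)]) (head (bidirect H) (f, b))" .
    moreover have "fst ` set (p @ [(f, b)]) \<subseteq> F" using p(2) f by simp
    ultimately show ?thesis unfolding R_def by blast
  qed
  have R_iff: "tail H f \<in> R \<longleftrightarrow> head H f \<in> R" if "f \<in> F" for f
    using step[of f True] step[of f False] that by (auto simp: bidirect_def)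
  have hR: "head H e \<in> R"
  proof -
    have "head H e \<in> verts (bidirect H)"
      using wf_digraph.head_in_verts[OF wf e] by (simp add: bidirect_def)
    then have "B.awalk (head H e) [] (head H e)" by (simp add: B.awalk_Nil_iff)
    then show ?thesis unfolding R_def by (intro CollectI exI[of _ "[]"]) simp
  qed
  show ?case
  proof (cases "tail H e \<in> R")
    case True
    then obtain p where p: "B.awalk (head H e) p (tail H e)" "fst ` set p \<subseteq> F"
      unfolding R_def by blast
    define q where "q = B.awalk_to_apath p"
    have q: "B.apath (head H e) q (tail H e)" using B.apath_awalk_to_apath[OF p(1)] by (simp add: q_def)
    have qF: "fst ` set q \<subseteq> F" using B.awalk_to_apath_subset[OF p(1)] p(2) by (auto simp: q_def)
    let ?c = "(e, True) # q"
    have te: "tail (bidirect H) (e, True) = tail H e" "head (bidirect H) (e, True) = head H e"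
      by (simp_all add: bidirect_def)
    have aw: "B.awalk (tail H e) ?c (tail H e)"
      using q te e arcsB by (auto simp: B.awalk_Cons_iff B.apath_def)
    have "B.cycle ?c" unfolding B.cycle_def
      using aw q te by (intro exI[of _ "tail H e"]) (auto simp: B.apath_def)
    moreover have "distinct (map fst ?c)"
      using apath_bidirect_distinct_edges[OF B.wf_digraph q] qF insert.hyps(2) by auto
    moreover have "fst ` set ?c \<subseteq> insert e F" using qF by auto
    ultimately have "walk_gain (integer_mod_group 2) \<psi> ?c = \<one>\<^bsub>integer_mod_group 2\<^esub>"
      using insert.prems(2) unfolding balanced_def undirected_cycle_def by blast
    then have "walk_gain (integer_mod_group 2) \<psi> ?c = 0" by simp
    moreover have wq: "walk_gain (integer_mod_group 2) \<psi> q \<in> {0, 1}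
        \<and> gain_sign (walk_gain (integer_mod_group 2) \<psi> q) = s (head H e) * s (tail H e)"
      by (rule walk_gain_potential[where H = H]) (use q qF F \<psi> s sF in \<open>auto simp: B.apath_def B.awalk_def\<close>)
    moreover have "walk_gain (integer_mod_group 2) \<psi> ?c = (\<psi> e + walk_gain (integer_mod_group 2) \<psi> q) mod 2"
      by (simp add: walk_gain_def)
    ultimately have "gain_sign (\<psi> e) * (s (head H e) * s (tail H e)) = 1"
      using gain_sign_mult[OF \<psi>[OF e]] gain_sign_eq_1_iff by metis
    then have "s (tail H e) = gain_sign (\<psi> e) * s (head H e)"
      using s[of "tail H e"] s[of "head H e"] gain_sign_cases[of "\<psi> e"] by auto
    with s sF show ?thesis unfolding has_potential_def by (intro exI[of _ s]) auto
  next
    case False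
    \<comment> \<open>The sign by which the new edge violates \<open>s\<close>. Multiplying by it on
      \<open>R\<close> repairs this edge, whose tail is outside \<open>R\<close>, and preserves the
      conditions on \<open>F\<close>, whose edges do not leave \<open>R\<close>.\<close>
    define c where "c = gain_sign (\<psi> e) * s (head H e) * s (tail H e)"
    have c: "c \<in> {1, -1}"
      using s[of "tail H e"] s[of "head H e"] gain_sign_cases[of "\<psi> e"] by (auto simp: c_def)
    define s' where "s' = (\<lambda>x. if x \<in> R then c * s x else s x)"
    have "s' x \<in> {1, -1}" for x using s[of x] c by (auto simp: s'_def)
    moreover have "s' (tail H f) = gain_sign (\<psi> f) * s' (head H f)" if "f \<in> F" for f
      using R_iff[OF that] sF[OF that] by (auto simp: s'_def)
    moreover have "s' (tail H e) = gain_sign (\<psi> e) * s' (head H e)"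
      using False hR s[of "tail H e"] s[of "head H e"] gain_sign_cases[of "\<psi> e"]
      by (auto simp: s'_def c_def)
    ultimately show ?thesis unfolding has_potential_def by (intro exI[of _ s']) auto
  qed
qed

text \<open>On a closed walk the telescoping product is the square of a sign.\<close>

lemma has_potential_imp_balanced:
  fixes H :: "('a, 'b) pre_digraph" and \<psi> :: "'b \<Rightarrow> int"
  assumes "F \<subseteq> arcs H" and \<psi>: "\<And>e. e \<in> arcs H \<Longrightarrow> \<psi> e \<in> {0, 1}"
    and "has_potential (tail H) (head H) (\<lambda>e. gain_sign (\<psi> e)) F"
  shows "balanced (integer_mod_group 2) H \<psi> F"
  unfolding balanced_def
proof (intro allI impI)
  fix c assume c: "undirected_cycle H c \<and> fst ` set c \<subseteq> F"
  obtain s where s: "\<And>x. s x \<in> {1, -1::real}"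
    and sF: "\<And>f. f \<in> F \<Longrightarrow> s (tail H f) = gain_sign (\<psi> f) * s (head H f)"
    using assms(3) unfolding has_potential_def by blast
  obtain u where "pre_digraph.cas (bidirect H) u c u"
    using c by (auto simp: undirected_cycle_def pre_digraph.cycle_def pre_digraph.awalk_def)
  from walk_gain_potential[OF this, of \<psi> s] c s sF assms(1) \<psi>
  have "gain_sign (walk_gain (integer_mod_group 2) \<psi> c) = s u * s u" by blast
  also have "\<dots> = 1" using s[of u] by auto
  finally show "walk_gain (integer_mod_group 2) \<psi> c = \<one>\<^bsub>integer_mod_group 2\<^esub>"
    by (simp add: gain_sign_eq_1_iff)
qed

section \<open>The rank of the rigidity matrix as a dimension of a function space\<close>

text \<open>The carrier-based notion of linear independence is carried over to functions on the
  naturals through coordinates; rank and dimension are then both the size of a largest independent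
  set of columns.\<close>

lemma rank_eq_dim_columns:
  assumes A: "A \<in> carrier_mat n m"
  shows "vec_space.rank n A = dim ((\<lambda>j i. if i < n then A $$ (i, j) else (0::real)) ` {..<m})"
proof -
  interpret vec_space "TYPE(real)" n .
  define \<phi> :: "real vec \<Rightarrow> nat \<Rightarrow> real" where "\<phi> = (\<lambda>v i. if i < n then vec_index v i else 0)"
  have cols: "set (cols A) \<subseteq> carrier_vec n" using cols_dim A by blast
  have lin: "lin_indpt S \<longleftrightarrow> indep_family S \<phi>" if "S \<subseteq> set (cols A)" for S
  proof -
    have S: "S \<subseteq> carrier_vec n" "finite S" using that cols finite_subset by auto
    have eq: "lincomb a S = 0\<^sub>v n \<longleftrightarrow> (\<Sum>v\<in>S. a v *\<^sub>R \<phi> v) = 0" for a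
    proof -
      have dim: "lincomb a S \<in> carrier_vec n" using S by simp
      have "lincomb a S = 0\<^sub>v n \<longleftrightarrow> (\<forall>i<n. vec_index (lincomb a S) i = 0)"
        using dim by (auto intro!: eq_vecI)
      also have "\<dots> \<longleftrightarrow> (\<forall>i. (\<Sum>v\<in>S. a v *\<^sub>R \<phi> v) i = 0)"
      proof -
        have "(\<Sum>v\<in>S. a v *\<^sub>R \<phi> v) i = (if i < n then vec_index (lincomb a S) i else 0)" for i
          using lincomb_index[of i S a] S by (simp add: sum_fun_apply \<phi>_def)
        then show ?thesis by auto
      qed
      finally show ?thesis by (simp add: fun_eq_iff)
    qed
    show ?thesis
    proof
      assume l: "lin_indpt S"
      show "indep_family S \<phi>" unfolding indep_family_def
      proof (intro allI impI ballI, rule ccontr)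
        fix c v assume c: "(\<Sum>v\<in>S. c v *\<^sub>R \<phi> v) = 0" "v \<in> S" "c v \<noteq> 0"
        have "lincomb c S = \<zero>\<^bsub>V\<^esub>" using c(1) eq[of c] by simp
        then have "lin_dep S" using c(2,3) S by (intro lin_dep_crit[of S S v c]) auto
        with l show False by simp
      qed
    next
      assume i: "indep_family S \<phi>"
      show "lin_indpt S"
      proof
        assume "lin_dep S"
        then obtain a v where "lincomb a S = \<zero>\<^bsub>V\<^esub>" "v \<in> S" "a v \<noteq> 0"
          using finite_lin_dep[OF S(2)] S(1) by auto
        with eq[of a] indep_familyD[OF i] show False by auto
      qed
    qed
  qed
  obtain S where S: "maximal S (\<lambda>T. T \<subseteq> set (cols A) \<and> lin_indpt T)"
    using maximal_exists_superset[of "set (cols A)" "\<lambda>T. T \<subseteq> set (cols A) \<and> lin_indpt T" "{}"]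
      lin[of "{}"] by (auto simp: indep_family_def)
  have S': "S \<subseteq> set (cols A)" "indep_family S \<phi>"
    using S lin unfolding maximal_def by auto
  have "card S \<le> Real_Vector_Spaces.dim (\<phi> ` set (cols A))"
    by (rule indep_family_card_le_dim[OF finite_subset[OF S'(1)] S'(2)])
      (use S'(1) in \<open>auto intro!: span_base\<close>)
  moreover have "Real_Vector_Spaces.dim (\<phi> ` set (cols A)) \<le> rank A"
  proof -
    obtain J where J: "J \<subseteq> set (cols A)" "indep_family J \<phi>" "card J = Real_Vector_Spaces.dim (\<phi> ` set (cols A))"
      using obtain_indep_subfamily[OF List.finite_set, of "cols A" \<phi>] by metis
    have "lin_indpt J" using lin[OF J(1)] J(2) by blast
    from rank_ge_card_indpt[OF A J(1) this] show ?thesis unfolding J(3) .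
  qed
  ultimately have "rank A = Real_Vector_Spaces.dim (\<phi> ` set (cols A))"
    using rank_card_indpt[OF A S] by simp
  also have "\<phi> ` set (cols A) = (\<lambda>j i. if i < n then A $$ (i, j) else 0) ` {..<m}"
  proof -
    have "set (cols A) = col A ` {..<m}" using A by (auto simp: cols_def)
    moreover have "\<phi> (col A j) = (\<lambda>i. if i < n then A $$ (i, j) else 0)" if "j < m" for j
      using A that by (auto simp: \<phi>_def fun_eq_iff)
    ultimately show ?thesis by (auto simp: image_image image_iff)
  qed
  finally show ?thesis .
qed

text \<open>
  Row rank versus column rank: the hypotheses say that the \<open>c j\<close> are the columns of a matrix
  whose rows are among the \<open>r i\<close>, up to reindexing.
\<close>
lemma dim_columns_le_dim_rows:
  fixes r :: "'i \<Rightarrow> 'y \<Rightarrow> real" and c :: "'j \<Rightarrow> 'x \<Rightarrow> real"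
  assumes "finite I" "f ` X \<subseteq> I"
    and c: "\<And>j x. j \<in> J \<Longrightarrow> c j x = (if x \<in> X then r (f x) (g j) else 0)"
  shows "dim (c ` J) \<le> dim (r ` I)"
proof -
  obtain K where K: "K \<subseteq> I" "indep_family K r" "card K = dim (r ` I)" "r ` I \<subseteq> span (r ` K)"
    using obtain_indep_subfamily[OF assms(1)] by metis
  have finK: "finite K" using K(1) assms(1) finite_subset by blast
  have inj: "inj_on r K" using K(2) indep_family_iff[OF finK] by blast
  have "\<exists>u. r i = (\<Sum>k\<in>K. u k *\<^sub>R r k)" if "i \<in> I" for i
  proof -
    have "r i \<in> span (r ` K)" using K(4) that by blast
    then obtain u where "r i = (\<Sum>v\<in>r ` K. u v *\<^sub>R v)"
      using real_vector.span_finite[of "r ` K"] finK by auto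
    then have "r i = (\<Sum>k\<in>K. u (r k) *\<^sub>R r k)" by (simp add: sum.reindex[OF inj])
    then show ?thesis by (intro exI[of _ "\<lambda>k. u (r k)"])
  qed
  then obtain u where u: "\<And>i. i \<in> I \<Longrightarrow> r i = (\<Sum>k\<in>K. u i k *\<^sub>R r k)" by metis
  \<comment> \<open>A rank factorization: coefficients that express the rows in a row basis also
    express all columns through the functions \<open>d k\<close>, one for each basis row.\<close>
  define d where "d = (\<lambda>k x. if x \<in> X then u (f x) k else 0)"
  have "c j \<in> span (d ` K)" if "j \<in> J" for j
  proof -
    have "c j x = (\<Sum>k\<in>K. r k (g j) *\<^sub>R d k) x" for x
    proof (cases "x \<in> X")
      case True
      then have "f x \<in> I" using assms(2) by blast
      then have "r (f x) (g j) = (\<Sum>k\<in>K. u (f x) k *\<^sub>R r k) (g j)" using u by metis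
      with True show ?thesis using c[OF that, of x] by (simp add: sum_fun_apply d_def mult.commute)
    qed (simp add: c[OF that] sum_fun_apply d_def)
    then have "c j = (\<Sum>k\<in>K. r k (g j) *\<^sub>R d k)" by blast
    moreover have "(\<Sum>k\<in>K. r k (g j) *\<^sub>R d k) \<in> span (d ` K)"
      by (intro span_sum span_scale span_base) auto
    ultimately show ?thesis by simp
  qed
  then have "dim (c ` J) \<le> card (d ` K)"
    using finK by (intro real_vector.dim_le_card) auto
  also have "\<dots> \<le> card K" using finK by (rule card_image_le)
  finally show ?thesis using K(3) by simp
qed

text \<open>Columns are labelled by vertex and coordinate instead of being numbered, which removes
  the arbitrary enumerations.\<close>

definition edge_row :: "('v \<Rightarrow> real^2) \<Rightarrow> 'v set \<Rightarrow> 'v \<times> 2 \<Rightarrow> real" where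
  "edge_row p e = (\<lambda>(v, k). if v \<in> e then vec_nth (p v - p (the_elem (e - {v}))) k else 0)"

lemma enumeration:
  assumes "finite A" shows "distinct (enumeration A)" "set (enumeration A) = A"
  using someI_ex[of "\<lambda>xs. distinct xs \<and> set xs = A"] finite_distinct_list[OF assms]
  unfolding enumeration_def by blast+

lemma enumeration_length: "finite A \<Longrightarrow> length (enumeration A) = card A"
  using enumeration distinct_card by metis

text \<open>\<open>dim_columns_le_dim_rows\<close> is applied in both directions, the numbered
  columns and the labelled rows exchanging roles.\<close>

lemma rigidity_rank_eq_dim:
  assumes G: "simple_graph V E"
  shows "rigidity_rank V E p = dim (edge_row p ` E)"
proof -
  have finV: "finite V" and EV: "\<And>e. e \<in> E \<Longrightarrow> e \<subseteq> V" using G by (auto simp: simple_graph_def)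
  then have finE: "finite E" by (meson Pow_iff finite_Pow_iff finite_subset subsetI)
  note enE = enumeration[OF finE] and enV = enumeration[OF finV]
  note lenE = enumeration_length[OF finE] and lenV = enumeration_length[OF finV]
  let ?A = "rigidity_matrix V E p"
  let ?c = "\<lambda>j i. if i < card E then ?A $$ (i, j) else 0"
  define g where "g = (\<lambda>j. (enumeration V ! (j div 2), if even j then 1 else 2 :: 2))"
  have A: "?A \<in> carrier_mat (card E) (2 * card V)" by (simp add: rigidity_matrix_def)
  have entry: "?A $$ (i, j) = edge_row p (enumeration E ! i) (g j)" if "i < card E" "j < 2 * card V" for i j
    using that by (auto simp: rigidity_matrix_def edge_row_def g_def Let_def)
  have rank: "rigidity_rank V E p = dim (?c ` {..<2 * card V})"
    unfolding rigidity_rank_def by (rule rank_eq_dim_columns[OF A])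
  have "dim (?c ` {..<2 * card V}) \<le> dim (edge_row p ` E)"
  proof (rule dim_columns_le_dim_rows[where f = "\<lambda>i. enumeration E ! i" and X = "{..<card E}" and g = g])
    show "(!) (enumeration E) ` {..<card E} \<subseteq> E"
      using enE(2) lenE by (auto simp: set_conv_nth)
  qed (use finE entry in auto)
  moreover have "dim (edge_row p ` E) \<le> dim (?c ` {..<2 * card V})"
  proof -
    have "\<forall>e\<in>E. \<exists>i<card E. enumeration E ! i = e" using enE(2) lenE by (metis in_set_conv_nth)
    then obtain ie where ie: "\<And>e. e \<in> E \<Longrightarrow> ie e < card E" "\<And>e. e \<in> E \<Longrightarrow> enumeration E ! ie e = e"
      by metis
    have "\<forall>v\<in>V. \<exists>i<card V. enumeration V ! i = v" using enV(2) lenV by (metis in_set_conv_nth)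
    then obtain iv where iv: "\<And>v. v \<in> V \<Longrightarrow> iv v < card V" "\<And>v. v \<in> V \<Longrightarrow> enumeration V ! iv v = v"
      by metis
    define f where "f = (\<lambda>(v, k :: 2). 2 * iv v + (if k = 1 then 0 else 1))"
    have gf: "g (f (v, k)) = (v, k)" if "v \<in> V" for v k
      using iv that exhaust_2[of k] by (auto simp: g_def f_def)
    show ?thesis
    proof (rule dim_columns_le_dim_rows[where f = f and X = "V \<times> UNIV" and g = ie])
      show sub: "f ` (V \<times> UNIV) \<subseteq> {..<2 * card V}"
        using iv(1) by (fastforce simp: f_def)
      show "edge_row p e x = (if x \<in> V \<times> UNIV then ?c (f x) (ie e) else 0)" if e: "e \<in> E" for e x
      proof (cases "x \<in> V \<times> UNIV")
        case True
        then have "f x < 2 * card V" using sub by blast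
        moreover have "g (f x) = x" using gf True by (cases x) auto
        ultimately show ?thesis using entry[OF ie(1)[OF e], of "f x"] ie[OF e] True by simp
      next
        case False
        then show ?thesis using EV[OF e] by (auto simp: edge_row_def split: prod.split)
      qed
    qed simp
  qed
  ultimately show ?thesis using rank by simp
qed

section \<open>Infinitesimal motions and gain sparsity\<close>

lemma in_span_point_fun:
  assumes "finite C" "\<And>x. x \<notin> C \<Longrightarrow> f x = 0"
  shows "f \<in> span (point_fun ` C)"
proof -
  have "f x = (\<Sum>c\<in>C. f c *\<^sub>R point_fun c) x" for x
  proof -
    have "(\<Sum>c\<in>C. f c *\<^sub>R point_fun c) x = (\<Sum>c\<in>C. if c = x then f c else 0)"
      unfolding sum_fun_apply by (rule sum.cong) (auto simp: point_fun_def)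
    then show ?thesis using assms by (cases "x \<in> C") auto
  qed
  then have "f = (\<Sum>c\<in>C. f c *\<^sub>R point_fun c)" by blast
  moreover have "(\<Sum>c\<in>C. f c *\<^sub>R point_fun c) \<in> span (point_fun ` C)"
    by (intro span_sum span_scale span_base) auto
  ultimately show ?thesis by simp
qed

text \<open>Two orthogonal independent families are jointly independent, because a vector in both
  spans is orthogonal to itself.\<close>

lemma card_rows_add_card_kernel_le:
  fixes w :: "'e \<Rightarrow> 'c \<Rightarrow> real" and z :: "'i \<Rightarrow> 'c \<Rightarrow> real"
  assumes fin: "finite F" "finite Z" "finite C"
    and w: "indep_family F w" and z: "indep_family Z z"
    and orth: "\<And>e i. e \<in> F \<Longrightarrow> i \<in> Z \<Longrightarrow> (\<Sum>c\<in>C. w e c * z i c) = 0"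
    and sw: "\<And>e c. e \<in> F \<Longrightarrow> c \<notin> C \<Longrightarrow> w e c = 0"
    and sz: "\<And>i c. i \<in> Z \<Longrightarrow> c \<notin> C \<Longrightarrow> z i c = 0"
  shows "card F + card Z \<le> card C"
proof -
  let ?f = "case_sum w z"
  have sum_f: "(\<Sum>k\<in>F <+> Z. a k *\<^sub>R ?f k) = (\<Sum>e\<in>F. a (Inl e) *\<^sub>R w e) + (\<Sum>i\<in>Z. a (Inr i) *\<^sub>R z i)" for a
    using fin by (simp add: sum.Plus)
  have "indep_family (F <+> Z) ?f" unfolding indep_family_def
  proof (intro allI impI)
    fix a assume a: "(\<Sum>k\<in>F <+> Z. a k *\<^sub>R ?f k) = 0"
    define x where "x = (\<Sum>e\<in>F. a (Inl e) *\<^sub>R w e)"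
    define y where "y = (\<Sum>i\<in>Z. a (Inr i) *\<^sub>R z i)"
    have xy: "x + y = 0" using a unfolding sum_f x_def y_def .
    have "(\<Sum>c\<in>C. x c * y c) = (\<Sum>c\<in>C. \<Sum>e\<in>F. \<Sum>i\<in>Z. a (Inl e) * a (Inr i) * (w e c * z i c))"
      by (simp add: x_def y_def sum_fun_apply sum_product mult_ac)
    also have "\<dots> = (\<Sum>e\<in>F. \<Sum>c\<in>C. \<Sum>i\<in>Z. a (Inl e) * a (Inr i) * (w e c * z i c))"
      by (rule sum.swap)
    also have "\<dots> = (\<Sum>e\<in>F. \<Sum>i\<in>Z. \<Sum>c\<in>C. a (Inl e) * a (Inr i) * (w e c * z i c))"
      by (intro sum.cong refl sum.swap)
    also have "\<dots> = (\<Sum>e\<in>F. \<Sum>i\<in>Z. a (Inl e) * a (Inr i) * (\<Sum>c\<in>C. w e c * z i c))"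
      by (simp only: sum_distrib_left)
    also have "\<dots> = 0" by (simp add: orth)
    finally have xy0: "(\<Sum>c\<in>C. x c * y c) = 0" .
    have xneg: "x c = - y c" for c using fun_cong[OF xy, of c] by simp
    then have "(\<Sum>c\<in>C. y c * y c) = 0" using xy0 by (simp add: sum_negf)
    then have "\<forall>c\<in>C. y c * y c = 0" using fin(3) by (subst (asm) sum_nonneg_eq_0_iff) auto
    moreover have "y c = 0" if "c \<notin> C" for c
      unfolding y_def sum_fun_apply by (rule sum.neutral) (simp add: sz that)
    ultimately have "y c = 0" for c by (cases "c \<in> C") auto
    then have y: "y = 0" by (simp add: fun_eq_iff)
    with xy have x: "x = 0" by simp
    have "\<forall>e\<in>F. a (Inl e) = 0"
      using w x unfolding indep_family_def x_def by (auto dest: spec[of _ "\<lambda>e. a (Inl e)"])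
    moreover have "\<forall>i\<in>Z. a (Inr i) = 0"
      using z y unfolding indep_family_def y_def by (auto dest: spec[of _ "\<lambda>i. a (Inr i)"])
    ultimately show "\<forall>k\<in>F <+> Z. a k = 0" by auto
  qed
  then have "card (F <+> Z) \<le> card (point_fun ` C)"
  proof (rule indep_family_card_le[rotated])
    show "?f ` (F <+> Z) \<subseteq> span (point_fun ` C)"
      using sw sz fin(3) by (auto intro!: in_span_point_fun)
  qed (use fin in auto)
  also have "\<dots> \<le> card C" using fin(3) by (rule card_image_le)
  finally show ?thesis using fin by (simp add: card_Plus)
qed

lemma rot90_linear:
  "rot90 (x - a *\<^sub>R y) = rot90 x - a *\<^sub>R rot90 y" "rot90 (a *\<^sub>R x) = a *\<^sub>R rot90 x"
  by (simp_all add: Finite_Cartesian_Product.vec_eq_iff forall_2)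

lemma inner_rot90_self [simp]: "x \<bullet> rot90 x = 0"
  by (simp add: inner_real_2)

lemma rot90_eq_0_iff [simp]: "rot90 x = 0 \<longleftrightarrow> x = 0"
  by (auto simp: Finite_Cartesian_Product.vec_eq_iff forall_2)

lemma sum_axis_eq_0:
  assumes "(\<Sum>k\<in>UNIV. c k *\<^sub>R (axis k 1 :: real^2)) = 0" shows "c k = 0"
proof -
  have "(\<Sum>k\<in>UNIV. c k *\<^sub>R (axis k 1 :: real^2)) $ k = (\<Sum>l\<in>UNIV. if l = k then c l else 0)"
    unfolding sum_component by (rule sum.cong) (auto simp: axis_def)
  with assms show ?thesis by simp
qed

context
  fixes t h :: "'e \<Rightarrow> 'x" and \<epsilon> :: "'e \<Rightarrow> real" and p :: "'x \<Rightarrow> real^2" and F :: "'e set"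
  assumes fin: "finite F" and ne: "F \<noteq> {}"
    and nz: "\<And>e. e \<in> F \<Longrightarrow> p (t e) - \<epsilon> e *\<^sub>R p (h e) \<noteq> 0"
begin

text \<open>Motions are cut off outside the endpoints of \<open>F\<close>, so that rows and motions
  share a space with two coordinates per endpoint.\<close>

lemma card_add_card_motions_le:
  fixes q :: "'i \<Rightarrow> 'x \<Rightarrow> real^2"
  assumes "finite Z"
    and ind: "indep_family F (\<lambda>e. tensor (p (t e) - \<epsilon> e *\<^sub>R p (h e)) (incidence_fun (\<eta> e) (t e) (h e)))"
    and orth: "\<And>e i. e \<in> F \<Longrightarrow> i \<in> Z \<Longrightarrow>
        (p (t e) - \<epsilon> e *\<^sub>R p (h e)) \<bullet> (q i (t e) - \<eta> e *\<^sub>R q i (h e)) = 0"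
    and q: "\<And>c i. (\<And>v. v \<in> t ` F \<union> h ` F \<Longrightarrow> (\<Sum>i\<in>Z. c i *\<^sub>R q i v) = 0) \<Longrightarrow> i \<in> Z \<Longrightarrow> c i = 0"
  shows "card F + card Z \<le> 2 * card (t ` F \<union> h ` F)"
proof -
  let ?W = "t ` F \<union> h ` F"
  have finW: "finite ?W" using fin by simp
  define z where "z = (\<lambda>i (v, k). if v \<in> ?W then q i v $ k else 0)"
  have "card F + card Z \<le> card (?W \<times> (UNIV :: 2 set))"
  proof (rule card_rows_add_card_kernel_le[OF fin assms(1) _ ind])
    show "indep_family Z z" unfolding indep_family_def
    proof (intro allI impI ballI)
      fix c i assume c: "(\<Sum>i\<in>Z. c i *\<^sub>R z i) = 0" and i: "i \<in> Z"
      have "(\<Sum>i\<in>Z. c i *\<^sub>R q i v) = 0" if "v \<in> ?W" for v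
      proof -
        have "(\<Sum>i\<in>Z. c i *\<^sub>R q i v) $ k = 0" for k
          using fun_cong[OF c, of "(v, k)"] that by (simp add: sum_fun_apply z_def sum_component)
        then show ?thesis by (simp add: Finite_Cartesian_Product.vec_eq_iff)
      qed
      from q[OF this i] show "c i = 0" .
    qed
    fix e i assume e: "e \<in> F" and i: "i \<in> Z"
    let ?r = "tensor (p (t e) - \<epsilon> e *\<^sub>R p (h e)) (incidence_fun (\<eta> e) (t e) (h e))"
    have "(\<Sum>c\<in>?W \<times> UNIV. ?r c * z i c) = (\<Sum>c\<in>?W \<times> UNIV. ?r c * q i (fst c) $ snd c)"
      by (rule sum.cong) (auto simp: z_def)
    also have "\<dots> = 0" using sum_tensor_incidence[OF finW, of "t e" "h e"] e orth[OF e i] by simp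
    finally show "(\<Sum>c\<in>?W \<times> UNIV. ?r c * z i c) = 0" .
  next
    fix e c assume "e \<in> F" "c \<notin> ?W \<times> (UNIV :: 2 set)"
    then show "tensor (p (t e) - \<epsilon> e *\<^sub>R p (h e)) (incidence_fun (\<eta> e) (t e) (h e)) c = 0"
      by (cases c) (auto simp: tensor_def incidence_fun_def point_fun_def)
  next
    fix i c assume "c \<notin> ?W \<times> (UNIV :: 2 set)"
    then show "z i c = 0" by (cases c) (auto simp: z_def)
  qed (use finW in simp)
  also have "card (?W \<times> (UNIV :: 2 set)) = 2 * card ?W" by (simp add: card_cartesian_product)
  finally show ?thesis .
qed

text \<open>The rotation about the origin commutes with the half-turn and descends to the quotient
  as \<open>rot90 (p v)\<close>. It cannot vanish at both ends of an edge whose vector is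
  nonzero.\<close>

lemma symmetric_rows_card_le:
  assumes "indep_family F (\<lambda>e. tensor (p (t e) - \<epsilon> e *\<^sub>R p (h e)) (incidence_fun (\<epsilon> e) (t e) (h e)))"
  shows "card F + 1 \<le> 2 * card (t ` F \<union> h ` F)"
proof -
  have "card F + card (UNIV :: unit set) \<le> 2 * card (t ` F \<union> h ` F)"
  proof (rule card_add_card_motions_le[OF _ assms, of UNIV "\<lambda>_ v. rot90 (p v)"])
    fix c :: "unit \<Rightarrow> real" and i
    assume c: "\<And>v. v \<in> t ` F \<union> h ` F \<Longrightarrow> (\<Sum>i\<in>UNIV. c i *\<^sub>R rot90 (p v)) = 0"
    obtain e where e: "e \<in> F" using ne by blast
    have z: "c () *\<^sub>R rot90 (p (t e)) = 0" "c () *\<^sub>R rot90 (p (h e)) = 0"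
      using c[of "t e"] c[of "h e"] e by (simp_all add: UNIV_unit)
    have "c () *\<^sub>R rot90 (p (t e) - \<epsilon> e *\<^sub>R p (h e))
        = c () *\<^sub>R rot90 (p (t e)) - \<epsilon> e *\<^sub>R (c () *\<^sub>R rot90 (p (h e)))"
      unfolding rot90_linear by (simp add: algebra_simps)
    also have "\<dots> = 0" unfolding z by simp
    finally have "c () *\<^sub>R rot90 (p (t e) - \<epsilon> e *\<^sub>R p (h e)) = 0" .
    with nz[OF e] show "c i = 0" by simp
  qed (simp_all add: rot90_linear(1)[symmetric])
  then show ?thesis by simp
qed

text \<open>A translation moves a vertex and its image with the same velocity, so in the quotient it
  is a constant function.\<close>

lemma antisymmetric_rows_card_le:
  assumes "indep_family F (\<lambda>e. tensor (p (t e) - \<epsilon> e *\<^sub>R p (h e)) (incidence_fun 1 (t e) (h e)))"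
  shows "card F + 2 \<le> 2 * card (t ` F \<union> h ` F)"
proof -
  have "card F + card (UNIV :: 2 set) \<le> 2 * card (t ` F \<union> h ` F)"
  proof (rule card_add_card_motions_le[OF _ assms, of UNIV "\<lambda>k _. axis k 1"])
    fix c :: "2 \<Rightarrow> real" and i
    assume c: "\<And>v. v \<in> t ` F \<union> h ` F \<Longrightarrow> (\<Sum>i\<in>UNIV. c i *\<^sub>R axis i 1) = (0 :: real^2)"
    obtain e where "e \<in> F" using ne by blast
    then show "c i = 0" using sum_axis_eq_0[OF c[of "t e"]] by simp
  qed simp_all
  then show ?thesis by simp
qed

text \<open>Multiplied by \<open>\<sigma>\<close> the translations, and by \<open>\<rho>\<close> the
  rotation, become orthogonal to the rows. For a potential \<open>s\<close>, symmetric rows use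
  \<open>\<sigma> = s\<close> and \<open>\<rho> = 1\<close>, antisymmetric rows
  \<open>\<sigma> = 1\<close> and \<open>\<rho> = s\<close>.\<close>

lemma switched_rows_card_le:
  fixes \<sigma> \<rho> :: "'x \<Rightarrow> real"
  assumes ind: "indep_family F (\<lambda>e. tensor (p (t e) - \<epsilon> e *\<^sub>R p (h e)) (incidence_fun (\<eta> e) (t e) (h e)))"
    and \<sigma>: "\<And>e. e \<in> F \<Longrightarrow> \<sigma> (t e) = \<eta> e * \<sigma> (h e)"
    and \<rho>: "\<And>e. e \<in> F \<Longrightarrow> \<eta> e * \<rho> (h e) = \<epsilon> e * \<rho> (t e)"
    and nz': "\<And>v. \<sigma> v \<noteq> 0" "\<And>v. \<rho> v \<noteq> 0"
  shows "card F + 3 \<le> 2 * card (t ` F \<union> h ` F)"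
proof -
  define q :: "2 option \<Rightarrow> 'x \<Rightarrow> real^2" where
    "q = (\<lambda>i v. case i of None \<Rightarrow> \<rho> v *\<^sub>R rot90 (p v) | Some k \<Rightarrow> \<sigma> v *\<^sub>R axis k 1)"
  have qN: "q None (t e) - \<eta> e *\<^sub>R q None (h e) = \<rho> (t e) *\<^sub>R rot90 (p (t e) - \<epsilon> e *\<^sub>R p (h e))"
    if "e \<in> F" for e
  proof -
    have eq: "\<eta> e *\<^sub>R q None (h e) = (\<rho> (t e) * \<epsilon> e) *\<^sub>R rot90 (p (h e))"
      using \<rho>[OF that] by (simp add: q_def)
    show ?thesis unfolding eq by (simp add: q_def rot90_linear algebra_simps)
  qed
  have qS: "q (Some k) (t e) - \<eta> e *\<^sub>R q (Some k) (h e) = 0" if "e \<in> F" for e k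
    using \<sigma>[OF that] by (simp add: q_def)
  have sumopt: "(\<Sum>i\<in>UNIV. f i) = f None + (\<Sum>k\<in>UNIV. f (Some k))" for f :: "2 option \<Rightarrow> real^2"
    by (simp add: UNIV_option_conv sum.reindex)
  have "card F + card (UNIV :: 2 option set) \<le> 2 * card (t ` F \<union> h ` F)"
  proof (rule card_add_card_motions_le[OF _ ind, of UNIV q])
    fix e i assume "e \<in> F"
    then show "(p (t e) - \<epsilon> e *\<^sub>R p (h e)) \<bullet> (q i (t e) - \<eta> e *\<^sub>R q i (h e)) = 0"
      by (cases i) (simp_all add: qN qS)
  next
    fix c :: "2 option \<Rightarrow> real" and i
    assume c: "\<And>v. v \<in> t ` F \<union> h ` F \<Longrightarrow> (\<Sum>i\<in>UNIV. c i *\<^sub>R q i v) = 0"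
    obtain e where e: "e \<in> F" using ne by blast
    let ?s = "\<lambda>v. (\<Sum>k\<in>UNIV. c (Some k) *\<^sub>R q (Some k) v)"
    have t: "c None *\<^sub>R q None (t e) + ?s (t e) = 0" and h: "c None *\<^sub>R q None (h e) + ?s (h e) = 0"
      using c[of "t e"] c[of "h e"] e unfolding sumopt by auto
    have "?s (t e) - \<eta> e *\<^sub>R ?s (h e) = (\<Sum>k\<in>UNIV. c (Some k) *\<^sub>R (q (Some k) (t e) - \<eta> e *\<^sub>R q (Some k) (h e)))"
      by (simp add: sum_subtractf scaleR_sum_right scaleR_diff_right mult.commute)
    then have s0: "?s (t e) - \<eta> e *\<^sub>R ?s (h e) = 0" by (simp add: qS[OF e])
    \<comment> \<open>Comparing the relation at both ends of one edge cancels the translations and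
      isolates the coefficient of the rotation, which meets a nonzero edge vector.\<close>
    have "c None *\<^sub>R (q None (t e) - \<eta> e *\<^sub>R q None (h e))
        = (c None *\<^sub>R q None (t e) + ?s (t e)) - \<eta> e *\<^sub>R (c None *\<^sub>R q None (h e) + ?s (h e))
          - (?s (t e) - \<eta> e *\<^sub>R ?s (h e))"
      by (simp add: algebra_simps)
    also have "\<dots> = 0" unfolding t h s0 by simp
    finally have cN: "c None = 0" using qN[OF e] nz[OF e] nz'(2)[of "t e"] by simp
    have "?s (t e) = \<sigma> (t e) *\<^sub>R (\<Sum>k\<in>UNIV. c (Some k) *\<^sub>R axis k 1)"
      by (simp add: q_def scaleR_sum_right mult.commute)
    then have "(\<Sum>k\<in>UNIV. c (Some k) *\<^sub>R (axis k 1 :: real^2)) = 0" using t cN nz'(1) by simp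
    then have "c (Some k) = 0" for k using sum_axis_eq_0[of "\<lambda>k. c (Some k)"] by blast
    with cN show "c i = 0" by (cases i) auto
  qed simp
  moreover have "card (UNIV :: 2 option set) = 3" by (simp add: card_UNIV_option)
  ultimately show ?thesis by simp
qed

end

section \<open>Symmetric and antisymmetric parts of the row space\<close>

lemma
  assumes "finite (arcs H)"
  shows gain_matroid_rank_ge: "I \<subseteq> arcs H \<Longrightarrow> gain_sparse \<Gamma> H \<psi> k l m I \<Longrightarrow> card I \<le> gain_matroid_rank \<Gamma> H \<psi> k l m"
    and gain_matroid_rank_attained: "\<exists>I. I \<subseteq> arcs H \<and> gain_sparse \<Gamma> H \<psi> k l m I \<and> card I = gain_matroid_rank \<Gamma> H \<psi> k l m"
proof -
  let ?S = "{card I | I. I \<subseteq> arcs H \<and> gain_sparse \<Gamma> H \<psi> k l m I}"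
  have "?S \<subseteq> card ` Pow (arcs H)" by auto
  then have fin: "finite ?S" using assms by (meson finite_Pow_iff finite_imageI finite_subset)
  have "gain_sparse \<Gamma> H \<psi> k l m {}" by (simp add: gain_sparse_def)
  then have ne: "?S \<noteq> {}" by auto
  show "card I \<le> gain_matroid_rank \<Gamma> H \<psi> k l m"
    if "I \<subseteq> arcs H" "gain_sparse \<Gamma> H \<psi> k l m I"
    unfolding gain_matroid_rank_def using that by (intro Max_ge[OF fin]) blast
  show "\<exists>I. I \<subseteq> arcs H \<and> gain_sparse \<Gamma> H \<psi> k l m I \<and> card I = gain_matroid_rank \<Gamma> H \<psi> k l m"
    using Max_in[OF fin ne] unfolding gain_matroid_rank_def by auto
qed

lemma edge_row_pair:
  assumes "u \<noteq> v"
  shows "edge_row p {u, v} (x, k) = (p u - p v) $ k * (point_fun u x - point_fun v x)"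
proof -
  have "{u, v} - {u} = {v}" "{u, v} - {v} = {u}" using assms by auto
  then show ?thesis using assms by (auto simp: edge_row_def point_fun_def)
qed

locale half_turn_quotient =
  fixes V :: "'v set" and E :: "'v set set" and \<gamma> :: "'v \<Rightarrow> 'v"
    and H :: "('v set, 'v set set) pre_digraph" and \<psi> :: "'v set set \<Rightarrow> int" and r :: "'v set \<Rightarrow> 'v"
  assumes simple: "simple_graph V E"
    and \<gamma>_in: "\<And>v. v \<in> V \<Longrightarrow> \<gamma> v \<in> V"
    and \<gamma>_\<gamma> [simp]: "\<And>v. v \<in> V \<Longrightarrow> \<gamma> (\<gamma> v) = v"
    and \<gamma>_neq: "\<And>v. v \<in> V \<Longrightarrow> \<gamma> v \<noteq> v"
    and \<gamma>_edge: "\<And>e. e \<in> E \<Longrightarrow> \<gamma> ` e \<in> E"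
    and verts: "verts H = (\<lambda>v. {v, \<gamma> v}) ` V"
    and arcs: "arcs H = (\<lambda>e. {e, \<gamma> ` e}) ` E"
    and rep: "\<And>X. X \<in> verts H \<Longrightarrow> r X \<in> X"
    and ends: "\<And>a. a \<in> arcs H \<Longrightarrow> tail H a \<in> verts H" "\<And>a. a \<in> arcs H \<Longrightarrow> head H a \<in> verts H"
    and gain: "\<And>a. a \<in> arcs H \<Longrightarrow> \<psi> a \<in> {0, 1}"
    and arc: "\<And>a. a \<in> arcs H \<Longrightarrow> a =
        {{r (tail H a), if \<psi> a = 0 then r (head H a) else \<gamma> (r (head H a))},
         \<gamma> ` {r (tail H a), if \<psi> a = 0 then r (head H a) else \<gamma> (r (head H a))}}"
begin

abbreviation "orb v \<equiv> {v, \<gamma> v}"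

abbreviation "\<epsilon> a \<equiv> gain_sign (\<psi> a)"

definition other_end :: "'v set set \<Rightarrow> 'v" where
  "other_end a = (if \<psi> a = 0 then r (head H a) else \<gamma> (r (head H a)))"

text \<open>The sign that relates the position of a vertex to that of its representative in an odd
  placement.\<close>

definition orient :: "'v \<Rightarrow> real" where
  "orient v = (if v = r (orb v) then 1 else -1)"

definition edge_vec :: "('v set \<Rightarrow> real^2) \<Rightarrow> 'v set set \<Rightarrow> real^2" where
  "edge_vec P a = P (tail H a) - \<epsilon> a *\<^sub>R P (head H a)"

definition sym_row :: "('v set \<Rightarrow> real^2) \<Rightarrow> 'v set set \<Rightarrow> 'v set \<times> 2 \<Rightarrow> real" where
  "sym_row P a = tensor (edge_vec P a) (incidence_fun (\<epsilon> a) (tail H a) (head H a))"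

definition anti_row :: "('v set \<Rightarrow> real^2) \<Rightarrow> 'v set set \<Rightarrow> 'v set \<times> 2 \<Rightarrow> real" where
  "anti_row P a = tensor (edge_vec P a) (incidence_fun 1 (tail H a) (head H a))"

text \<open>Its values are odd under \<open>\<gamma>\<close>, those of \<open>anti_lift\<close>
  even: a motion commutes with the half-turn exactly when it takes opposite values at a vertex and
  its image.\<close>

definition sym_lift :: "('v set \<times> 2 \<Rightarrow> real) \<Rightarrow> 'v \<times> 2 \<Rightarrow> real" where
  "sym_lift f = (\<lambda>(v, k). if v \<in> V then orient v * f (orb v, k) else 0)"

definition anti_lift :: "('v set \<times> 2 \<Rightarrow> real) \<Rightarrow> 'v \<times> 2 \<Rightarrow> real" where
  "anti_lift f = (\<lambda>(v, k). if v \<in> V then f (orb v, k) else 0)"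

lemma linear_sym_lift: "linear sym_lift"
  by (rule linearI) (auto simp: sym_lift_def fun_eq_iff algebra_simps)

lemma linear_anti_lift: "linear anti_lift"
  by (rule linearI) (auto simp: anti_lift_def fun_eq_iff)

lemma finite_E: "finite E"
proof -
  have "E \<subseteq> Pow V" "finite V" using simple by (auto simp: simple_graph_def)
  then show ?thesis by (meson finite_Pow_iff finite_subset)
qed

lemma finite_arcs: "finite (arcs H)"
  using finite_E by (simp add: arcs)

lemma wf_H: "wf_digraph H"
  using ends by unfold_locales

lemma rep_in_V: "X \<in> verts H \<Longrightarrow> r X \<in> V"
  using rep[of X] \<gamma>_in by (auto simp: verts)

lemma orb_rep: "X \<in> verts H \<Longrightarrow> orb (r X) = X"
  using rep[of X] by (auto simp: verts)

lemma orb_\<gamma>: "v \<in> V \<Longrightarrow> orb (\<gamma> v) = orb v"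
  by auto

lemma orb_eq_iff: "X \<in> verts H \<Longrightarrow> v \<in> V \<Longrightarrow> orb v = X \<longleftrightarrow> v = r X \<or> v = \<gamma> (r X)"
  using orb_rep[of X] orb_\<gamma>[OF rep_in_V[of X]] by (metis insertCI insertE singletonD)

lemma orient_rep: "X \<in> verts H \<Longrightarrow> orient (r X) = 1"
  by (simp add: orient_def orb_rep)

lemma orient_\<gamma>_rep: "X \<in> verts H \<Longrightarrow> orient (\<gamma> (r X)) = -1"
  using orb_\<gamma>[OF rep_in_V[of X]] orb_rep[of X] \<gamma>_neq[OF rep_in_V[of X]] by (simp add: orient_def)

lemma orient_point_fun:
  assumes "X \<in> verts H" "v \<in> V"
  shows "orient v * point_fun X (orb v) = point_fun (r X) v - point_fun (\<gamma> (r X)) v"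
proof -
  have "r X \<noteq> \<gamma> (r X)" using \<gamma>_neq rep_in_V assms(1) by metis
  then show ?thesis using orb_eq_iff[OF assms] orient_rep[OF assms(1)] orient_\<gamma>_rep[OF assms(1)]
    by (auto simp: point_fun_def)
qed

lemma point_fun_orb:
  assumes "X \<in> verts H" "v \<in> V"
  shows "point_fun X (orb v) = point_fun (r X) v + point_fun (\<gamma> (r X)) v"
proof -
  have "r X \<noteq> \<gamma> (r X)" using \<gamma>_neq rep_in_V assms(1) by metis
  then show ?thesis using orb_eq_iff[OF assms] by (auto simp: point_fun_def)
qed

lemma arc_edges:
  assumes "a \<in> arcs H"
  shows "{r (tail H a), other_end a} \<in> E" "{\<gamma> (r (tail H a)), \<gamma> (other_end a)} \<in> E"
    and "r (tail H a) \<noteq> other_end a" "\<gamma> (r (tail H a)) \<noteq> \<gamma> (other_end a)"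
    and "a = {{r (tail H a), other_end a}, {\<gamma> (r (tail H a)), \<gamma> (other_end a)}}"
proof -
  show a: "a = {{r (tail H a), other_end a}, {\<gamma> (r (tail H a)), \<gamma> (other_end a)}}"
    using arc[OF assms] by (simp add: other_end_def)
  obtain e where "e \<in> E" "a = {e, \<gamma> ` e}" using assms by (auto simp: arcs)
  then have sub: "a \<subseteq> E" using \<gamma>_edge by auto
  have "{r (tail H a), other_end a} \<in> a" "{\<gamma> (r (tail H a)), \<gamma> (other_end a)} \<in> a"
    by (subst a, simp)+
  then show *: "{r (tail H a), other_end a} \<in> E" "{\<gamma> (r (tail H a)), \<gamma> (other_end a)} \<in> E"
    using sub by auto
  have "card {r (tail H a), other_end a} = 2" "card {\<gamma> (r (tail H a)), \<gamma> (other_end a)} = 2"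
    using simple * by (auto simp: simple_graph_def)
  then show "r (tail H a) \<noteq> other_end a" "\<gamma> (r (tail H a)) \<noteq> \<gamma> (other_end a)" by auto
qed

lemma edge_in_arc_cases:
  assumes "a \<in> arcs H" "e \<in> a"
  shows "e = {r (tail H a), other_end a} \<or> e = {\<gamma> (r (tail H a)), \<gamma> (other_end a)}"
proof -
  have "e \<in> {{r (tail H a), other_end a}, {\<gamma> (r (tail H a)), \<gamma> (other_end a)}}"
    by (subst arc_edges(5)[OF assms(1), symmetric]) (rule assms(2))
  then show ?thesis by simp
qed

lemma edge_in_arc: "e \<in> E \<Longrightarrow> \<exists>a\<in>arcs H. e \<in> a"
  by (auto simp: arcs)

lemma other_end_in_V: "a \<in> arcs H \<Longrightarrow> other_end a \<in> V"
  using rep_in_V[OF ends(2)] \<gamma>_in by (simp add: other_end_def)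

context
  fixes p :: "'v \<Rightarrow> real^2"
  assumes odd: "\<And>v. v \<in> V \<Longrightarrow> p (\<gamma> v) = - p v"
begin

lemma edge_vec_eq:
  assumes "a \<in> arcs H"
  shows "edge_vec (p \<circ> r) a = p (r (tail H a)) - p (other_end a)"
  using odd[OF rep_in_V[OF ends(2)[OF assms]]]
  by (simp add: edge_vec_def other_end_def gain_sign_def)

text \<open>The half-turn exchanges the two edge rows of an orbit, up to the odd or even sign, so
  the lifted rows are their sum and difference. For a fixed edge the two edges coincide, in
  accordance with the zero antisymmetric row of a loop.\<close>

lemma edge_row_arc:
  assumes a: "a \<in> arcs H"
  shows "sym_lift (sym_row (p \<circ> r) a) + anti_lift (anti_row (p \<circ> r) a)
      = 2 *\<^sub>R edge_row p {r (tail H a), other_end a}"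
    and "sym_lift (sym_row (p \<circ> r) a) - anti_lift (anti_row (p \<circ> r) a)
      = 2 *\<^sub>R edge_row p {\<gamma> (r (tail H a)), \<gamma> (other_end a)}"
proof -
  let ?u = "r (tail H a)" and ?w = "other_end a" and ?D = "edge_vec (p \<circ> r) a"
  have uV: "?u \<in> V" "?w \<in> V" using rep_in_V[OF ends(1)[OF a]] other_end_in_V[OF a] by auto
  have neg: "p (\<gamma> ?u) - p (\<gamma> ?w) = - ?D" using odd uV edge_vec_eq[OF a] by simp
  have sX: "orient v * point_fun (tail H a) (orb v) = point_fun ?u v - point_fun (\<gamma> ?u) v" if "v \<in> V" for v
    using orient_point_fun[OF ends(1)[OF a] that] .
  have tX: "point_fun (tail H a) (orb v) = point_fun ?u v + point_fun (\<gamma> ?u) v" if "v \<in> V" for v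
    using point_fun_orb[OF ends(1)[OF a] that] .
  have hV: "r (head H a) \<in> V" using rep_in_V[OF ends(2)[OF a]] .
  have sY: "orient v * (\<epsilon> a * point_fun (head H a) (orb v)) = point_fun ?w v - point_fun (\<gamma> ?w) v" if "v \<in> V" for v
    using orient_point_fun[OF ends(2)[OF a] that] hV
    by (auto simp: other_end_def gain_sign_def)
  have tY: "point_fun (head H a) (orb v) = point_fun ?w v + point_fun (\<gamma> ?w) v" if "v \<in> V" for v
    using point_fun_orb[OF ends(2)[OF a] that] hV by (auto simp: other_end_def)
  have S: "sym_lift (sym_row (p \<circ> r) a) (v, k) = ?D $ k *
      (point_fun ?u v - point_fun (\<gamma> ?u) v - point_fun ?w v + point_fun (\<gamma> ?w) v)" if "v \<in> V" for v k
  proof -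
    have "sym_lift (sym_row (p \<circ> r) a) (v, k) = ?D $ k *
      (orient v * point_fun (tail H a) (orb v) - orient v * (\<epsilon> a * point_fun (head H a) (orb v)))"
      using that by (simp add: sym_lift_def sym_row_def tensor_def incidence_fun_def algebra_simps)
    then show ?thesis unfolding sX[OF that] sY[OF that] by simp
  qed
  have T: "anti_lift (anti_row (p \<circ> r) a) (v, k) = ?D $ k *
      (point_fun ?u v + point_fun (\<gamma> ?u) v - point_fun ?w v - point_fun (\<gamma> ?w) v)" if "v \<in> V" for v k
  proof -
    have "anti_lift (anti_row (p \<circ> r) a) (v, k) = ?D $ k *
      (point_fun (tail H a) (orb v) - point_fun (head H a) (orb v))"
      using that by (simp add: anti_lift_def anti_row_def tensor_def incidence_fun_def)
    then show ?thesis unfolding tX[OF that] tY[OF that] by simp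
  qed
  have out: "point_fun x v = 0" if "x \<in> V" "v \<notin> V" for x v using that by (auto simp: point_fun_def)
  have outS: "sym_lift f (v, k) = 0" "anti_lift f (v, k) = 0" if "v \<notin> V" for f v k
    using that by (simp_all add: sym_lift_def anti_lift_def)
  show "sym_lift (sym_row (p \<circ> r) a) + anti_lift (anti_row (p \<circ> r) a) = 2 *\<^sub>R edge_row p {?u, ?w}"
  proof
    fix x :: "'v \<times> 2"
    obtain v k where x: "x = (v, k)" by force
    show "(sym_lift (sym_row (p \<circ> r) a) + anti_lift (anti_row (p \<circ> r) a)) x = (2 *\<^sub>R edge_row p {?u, ?w}) x"
      unfolding x by (cases "v \<in> V")
        (simp_all add: S T outS edge_row_pair[OF arc_edges(3)[OF a]] edge_vec_eq[OF a] out uV algebra_simps)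
  qed
  show "sym_lift (sym_row (p \<circ> r) a) - anti_lift (anti_row (p \<circ> r) a) = 2 *\<^sub>R edge_row p {\<gamma> ?u, \<gamma> ?w}"
  proof
    fix x :: "'v \<times> 2"
    obtain v k where x: "x = (v, k)" by force
    show "(sym_lift (sym_row (p \<circ> r) a) - anti_lift (anti_row (p \<circ> r) a)) x = (2 *\<^sub>R edge_row p {\<gamma> ?u, \<gamma> ?w}) x"
      unfolding x by (cases "v \<in> V")
        (simp_all add: S T outS edge_row_pair[OF arc_edges(4)[OF a]] neg out uV \<gamma>_in algebra_simps
          del: vector_minus_component)
  qed
qed

lemma rank_le_gain_matroid_ranks:
  assumes nz: "\<And>u v. u \<in> V \<Longrightarrow> v \<in> V \<Longrightarrow> {u, v} \<in> E \<Longrightarrow> p u \<noteq> p v"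
  shows "dim (edge_row p ` E) \<le> gain_matroid_rank (integer_mod_group 2) H \<psi> 2 3 1
      + gain_matroid_rank (integer_mod_group 2) H \<psi> 2 3 2"
proof -
  let ?P = "p \<circ> r"
  have D: "?P (tail H a) - \<epsilon> a *\<^sub>R ?P (head H a) \<noteq> 0" if "a \<in> arcs H" for a
    using nz[OF rep_in_V[OF ends(1)[OF that]] other_end_in_V[OF that] arc_edges(1)[OF that]]
      edge_vec_eq[OF that] by (simp add: edge_vec_def)
  obtain I where I: "I \<subseteq> arcs H" "indep_family I (sym_row ?P)"
    "sym_row ?P ` arcs H \<subseteq> span (sym_row ?P ` I)"
    using obtain_indep_subfamily[OF finite_arcs] by metis
  obtain J where J: "J \<subseteq> arcs H" "indep_family J (anti_row ?P)"
    "anti_row ?P ` arcs H \<subseteq> span (anti_row ?P ` J)"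
    using obtain_indep_subfamily[OF finite_arcs] by metis
  have finIJ: "finite I" "finite J" using I(1) J(1) finite_arcs finite_subset by blast+
  have pot: "\<exists>s. (\<forall>x. s x \<in> {1, -1}) \<and> (\<forall>e\<in>F. s (tail H e) = \<epsilon> e * s (head H e))"
    if "F \<subseteq> arcs H" "balanced (integer_mod_group 2) H \<psi> F" for F
    using balanced_imp_has_potential[OF wf_H finite_subset[OF that(1) finite_arcs] that(1) gain that(2)]
    unfolding has_potential_def by simp
  have "gain_sparse (integer_mod_group 2) H \<psi> 2 3 1 I" unfolding gain_sparse_def
  proof (intro allI impI)
    fix F assume F: "F \<subseteq> I" "F \<noteq> {}"
    have FA: "F \<subseteq> arcs H" "finite F" using F I(1) finIJ finite_subset by blast+
    have ind: "indep_family F (\<lambda>e. tensor (?P (tail H e) - \<epsilon> e *\<^sub>R ?P (head H e))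
        (incidence_fun (\<epsilon> e) (tail H e) (head H e)))"
      using indep_family_mono[OF finIJ(1) I(2) F(1)] by (simp add: sym_row_def[abs_def] edge_vec_def)
    have Dnz: "?P (tail H e) - \<epsilon> e *\<^sub>R ?P (head H e) \<noteq> 0" if "e \<in> F" for e
      using D FA(1) that by blast
    have "card F + 1 \<le> 2 * card (edge_ends H F)"
      unfolding edge_ends_def by (rule symmetric_rows_card_le[OF FA(2) F(2) Dnz ind])
    moreover have "card F + 3 \<le> 2 * card (edge_ends H F)" if "balanced (integer_mod_group 2) H \<psi> F"
    proof -
      obtain s where s: "\<And>x. s x \<in> {1, -1::real}" "\<And>e. e \<in> F \<Longrightarrow> s (tail H e) = \<epsilon> e * s (head H e)"
        using pot[OF FA(1) \<open>balanced (integer_mod_group 2) H \<psi> F\<close>] by blast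
      have "s x \<noteq> 0" for x using s(1)[of x] by auto
      \<comment> \<open>In symmetric rows the incidence functions carry the signs, so the
        translations are switched.\<close>
      then show ?thesis unfolding edge_ends_def
        using switched_rows_card_le[OF FA(2) F(2) Dnz ind, where \<sigma> = s and \<rho> = "\<lambda>_. 1"] s(2) by simp
    qed
    ultimately show "(balanced (integer_mod_group 2) H \<psi> F \<longrightarrow> int (card F) \<le> int 2 * int (card (edge_ends H F)) - int 3)
        \<and> int (card F) \<le> int 2 * int (card (edge_ends H F)) - int 1"
      by linarith
  qed
  then have cI: "card I \<le> gain_matroid_rank (integer_mod_group 2) H \<psi> 2 3 1"
    using gain_matroid_rank_ge[OF finite_arcs I(1)] by blast
  have "gain_sparse (integer_mod_group 2) H \<psi> 2 3 2 J" unfolding gain_sparse_def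
  proof (intro allI impI)
    fix F assume F: "F \<subseteq> J" "F \<noteq> {}"
    have FA: "F \<subseteq> arcs H" "finite F" using F J(1) finIJ finite_subset by blast+
    have ind: "indep_family F (\<lambda>e. tensor (?P (tail H e) - \<epsilon> e *\<^sub>R ?P (head H e))
        (incidence_fun 1 (tail H e) (head H e)))"
      using indep_family_mono[OF finIJ(2) J(2) F(1)] by (simp add: anti_row_def[abs_def] edge_vec_def)
    have Dnz: "?P (tail H e) - \<epsilon> e *\<^sub>R ?P (head H e) \<noteq> 0" if "e \<in> F" for e
      using D FA(1) that by blast
    have "card F + 2 \<le> 2 * card (edge_ends H F)"
      unfolding edge_ends_def by (rule antisymmetric_rows_card_le[OF FA(2) F(2) Dnz ind])
    moreover have "card F + 3 \<le> 2 * card (edge_ends H F)" if "balanced (integer_mod_group 2) H \<psi> F"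
    proof -
      obtain s where s: "\<And>x. s x \<in> {1, -1::real}" "\<And>e. e \<in> F \<Longrightarrow> s (tail H e) = \<epsilon> e * s (head H e)"
        using pot[OF FA(1) \<open>balanced (integer_mod_group 2) H \<psi> F\<close>] by blast
      have "s x \<noteq> 0" for x using s(1)[of x] by auto
      moreover have "s (head H e) = \<epsilon> e * s (tail H e)" if "e \<in> F" for e
        using s(2)[OF that] by (simp add: mult.assoc[symmetric])
      \<comment> \<open>In antisymmetric rows only the edge vectors carry the signs, so the rotation
        is switched.\<close>
      ultimately show ?thesis unfolding edge_ends_def
        using switched_rows_card_le[OF FA(2) F(2) Dnz ind, where \<sigma> = "\<lambda>_. 1" and \<rho> = s] by simp
    qed
    ultimately show "(balanced (integer_mod_group 2) H \<psi> F \<longrightarrow> int (card F) \<le> int 2 * int (card (edge_ends H F)) - int 3)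
        \<and> int (card F) \<le> int 2 * int (card (edge_ends H F)) - int 2"
      by linarith
  qed
  then have cJ: "card J \<le> gain_matroid_rank (integer_mod_group 2) H \<psi> 2 3 2"
    using gain_matroid_rank_ge[OF finite_arcs J(1)] by blast
  \<comment> \<open>By \<open>edge_row_arc\<close>, lifted bases of the two row spaces together span
    every edge row.\<close>
  define B where "B = sym_lift ` sym_row ?P ` I \<union> anti_lift ` anti_row ?P ` J"
  have finB: "finite B" using finIJ by (simp add: B_def)
  have SB: "sym_lift (sym_row ?P a) \<in> span B" if "a \<in> arcs H" for a
  proof -
    have "sym_lift (sym_row ?P a) \<in> span (sym_lift ` sym_row ?P ` I)"
      using I(3) that linear_span_image[OF linear_sym_lift, of "sym_row ?P ` I"] by blast
    then show ?thesis using span_mono[of "sym_lift ` sym_row ?P ` I" B] by (auto simp: B_def)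
  qed
  have TB: "anti_lift (anti_row ?P a) \<in> span B" if "a \<in> arcs H" for a
  proof -
    have "anti_lift (anti_row ?P a) \<in> span (anti_lift ` anti_row ?P ` J)"
      using J(3) that linear_span_image[OF linear_anti_lift, of "anti_row ?P ` J"] by blast
    then show ?thesis using span_mono[of "anti_lift ` anti_row ?P ` J" B] by (auto simp: B_def)
  qed
  have "edge_row p e \<in> span B" if e: "e \<in> E" for e
  proof -
    obtain a where a: "a \<in> arcs H" "e \<in> a" using edge_in_arc[OF e] by blast
    then consider "e = {r (tail H a), other_end a}" | "e = {\<gamma> (r (tail H a)), \<gamma> (other_end a)}"
      using edge_in_arc_cases by blast
    then have "2 *\<^sub>R edge_row p e \<in> span B"
      using edge_row_arc[OF a(1)] span_add[OF SB[OF a(1)] TB[OF a(1)]] span_diff[OF SB[OF a(1)] TB[OF a(1)]]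
      by cases simp_all
    from span_scale[OF this, of "1/2"] show ?thesis by simp
  qed
  then have "dim (edge_row p ` E) \<le> card B" using finB by (intro real_vector.dim_le_card) auto
  also have "\<dots> \<le> card (sym_lift ` sym_row ?P ` I) + card (anti_lift ` anti_row ?P ` J)"
    unfolding B_def by (rule card_Un_le)
  also have "\<dots> \<le> card I + card J"
    using finIJ by (simp add: image_comp add_mono card_image_le)
  finally show ?thesis using cI cJ by linarith
qed

text \<open>An odd and an even function can only cancel if both vanish, so the two lifted families
  remain jointly independent inside the row space.\<close>

lemma card_indep_rows_le_rank:
  assumes I: "I \<subseteq> arcs H" "indep_family I (sym_row (p \<circ> r))"
    and J: "J \<subseteq> arcs H" "indep_family J (anti_row (p \<circ> r))"
  shows "card I + card J \<le> dim (edge_row p ` E)"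
proof -
  let ?P = "p \<circ> r"
  have finIJ: "finite I" "finite J" using I(1) J(1) finite_arcs finite_subset by blast+
  let ?f = "case_sum (sym_lift \<circ> sym_row ?P) (anti_lift \<circ> anti_row ?P)"
  have supp: "sym_row ?P a (X, k) = 0" "anti_row ?P a (X, k) = 0" if "a \<in> arcs H" "X \<notin> verts H" for a X k
    using ends[OF that(1)] that(2)
    by (auto simp: sym_row_def anti_row_def tensor_def incidence_fun_def point_fun_def)
  have "indep_family (I <+> J) ?f" unfolding indep_family_def
  proof (intro allI impI)
    fix c assume c: "(\<Sum>i\<in>I <+> J. c i *\<^sub>R ?f i) = 0"
    define x where "x = (\<Sum>a\<in>I. c (Inl a) *\<^sub>R sym_row ?P a)"
    define y where "y = (\<Sum>a\<in>J. c (Inr a) *\<^sub>R anti_row ?P a)"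
    have "sym_lift x + anti_lift y = (\<Sum>i\<in>I <+> J. c i *\<^sub>R ?f i)"
      using finIJ linear_sym_lift linear_anti_lift
      by (simp add: sum.Plus x_def y_def linear_sum linear_scale)
    then have xy: "sym_lift x + anti_lift y = 0" using c by simp
    \<comment> \<open>The values at a representative and at its image give the sum and the
      difference of the two parts.\<close>
    have xX: "x (X, k) = 0 \<and> y (X, k) = 0" if X: "X \<in> verts H" for X k
    proof -
      have "x (X, k) + y (X, k) = 0"
        using fun_cong[OF xy, of "(r X, k)"] rep_in_V[OF X] orb_rep[OF X] orient_rep[OF X]
        by (simp add: sym_lift_def anti_lift_def)
      moreover have "- x (X, k) + y (X, k) = 0"
        using fun_cong[OF xy, of "(\<gamma> (r X), k)"] rep_in_V[OF X] orb_rep[OF X] orient_\<gamma>_rep[OF X]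
          orb_\<gamma>[OF rep_in_V[OF X]] \<gamma>_in[OF rep_in_V[OF X]]
        by (simp add: sym_lift_def anti_lift_def)
      ultimately show ?thesis by linarith
    qed
    have "x z = 0" "y z = 0" for z
    proof -
      obtain X k where z: "z = (X, k)" by force
      have "x (X, k) = 0" "y (X, k) = 0" if "X \<notin> verts H"
        unfolding x_def y_def sum_fun_apply using supp that I(1) J(1) by (auto intro!: sum.neutral)
      with xX show "x z = 0" "y z = 0" unfolding z by blast+
    qed
    then have "x = 0" "y = 0" by (simp_all add: fun_eq_iff)
    then have "\<forall>a\<in>I. c (Inl a) = 0" "\<forall>a\<in>J. c (Inr a) = 0"
      using indep_familyD[OF I(2), of "\<lambda>a. c (Inl a)"] indep_familyD[OF J(2), of "\<lambda>a. c (Inr a)"]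
      unfolding x_def y_def by blast+
    then show "\<forall>i\<in>I <+> J. c i = 0" by auto
  qed
  then have "card (I <+> J) \<le> dim (edge_row p ` E)"
  proof (rule indep_family_card_le_dim[rotated])
    have "sym_lift (sym_row ?P a) \<in> span (edge_row p ` E) \<and> anti_lift (anti_row ?P a) \<in> span (edge_row p ` E)"
      if a: "a \<in> arcs H" for a
    proof -
      let ?e = "edge_row p {r (tail H a), other_end a}" and ?e' = "edge_row p {\<gamma> (r (tail H a)), \<gamma> (other_end a)}"
      have e: "?e \<in> span (edge_row p ` E)" "?e' \<in> span (edge_row p ` E)"
        using arc_edges(1,2)[OF a] by (auto intro: span_base)
      have "2 *\<^sub>R sym_lift (sym_row ?P a) = 2 *\<^sub>R (?e + ?e')"
        unfolding scaleR_add_right edge_row_arc[OF a, symmetric] by (simp add: scaleR_2)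
      moreover have "2 *\<^sub>R anti_lift (anti_row ?P a) = 2 *\<^sub>R (?e - ?e')"
        unfolding scaleR_diff_right edge_row_arc[OF a, symmetric] by (simp add: scaleR_2)
      ultimately have "sym_lift (sym_row ?P a) = ?e + ?e'" "anti_lift (anti_row ?P a) = ?e - ?e'"
        by (simp_all only: scaleR_cancel_left) simp_all
      with e show ?thesis by (simp add: span_add span_diff)
    qed
    then show "?f ` (I <+> J) \<subseteq> span (edge_row p ` E)" using I(1) J(1) by auto
  qed (use finIJ finite_E in auto)
  then show ?thesis using finIJ by (simp add: card_Plus)
qed

end

section \<open>Realizing sparse sets by odd placements\<close>

lemma ex_sym_realization:
  assumes I: "I \<subseteq> arcs H" "gain_sparse (integer_mod_group 2) H \<psi> 2 3 1 I"
  shows "\<exists>P. indep_family I (sym_row P)"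
proof -
  have finI: "finite I" using I(1) finite_arcs finite_subset by blast
  have hall: "card F + 1 \<le> 2 * dim ((\<lambda>e. incidence_fun (\<epsilon> e) (tail H e) (head H e)) ` F)"
    if F: "F \<subseteq> I" "F \<noteq> {}" for F
  proof (rule card_le_incidence_dim[OF finite_subset[OF F(1) finI] F(2)])
    fix F' assume F': "F' \<subseteq> F" "F' \<noteq> {}"
    have sp: "(balanced (integer_mod_group 2) H \<psi> F' \<longrightarrow> int (card F') \<le> int 2 * int (card (edge_ends H F')) - int 3)
        \<and> int (card F') \<le> int 2 * int (card (edge_ends H F')) - int 1"
      using I(2) F' F(1) unfolding gain_sparse_def by blast
    then show "card F' + 1 \<le> 2 * card (tail H ` F' \<union> head H ` F')"
      unfolding edge_ends_def by linarith
    assume pot: "has_potential (tail H) (head H) (\<lambda>e. \<epsilon> e) F'"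
    have "balanced (integer_mod_group 2) H \<psi> F'"
      by (rule has_potential_imp_balanced[OF _ gain pot]) (use F' F(1) I(1) in auto)
    with sp show "card F' + 1 + 2 \<le> 2 * card (tail H ` F' \<union> head H ` F')"
      unfolding edge_ends_def by linarith
  qed (simp add: gain_sign_def)
  have "card F \<le> 2 * dim ((\<lambda>e. incidence_fun (\<epsilon> e) (tail H e) (head H e)) ` F)" if "F \<subseteq> I" for F
    using hall[OF that] by (cases "F = {}") auto
  from ex_realization_with_indep_rows[OF finI hall this]
  show ?thesis by (simp add: sym_row_def[abs_def] edge_vec_def)
qed

text \<open>The directions are governed by signed incidence, the rows by unsigned incidence. The
  (2,3,2) count serves both: for the former it is more than the required (2,3,1) count.\<close>

lemma ex_anti_realization:
  assumes J: "J \<subseteq> arcs H" "gain_sparse (integer_mod_group 2) H \<psi> 2 3 2 J"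
  shows "\<exists>P. indep_family J (anti_row P)"
proof -
  have finJ: "finite J" using J(1) finite_arcs finite_subset by blast
  have sp: "(balanced (integer_mod_group 2) H \<psi> F \<longrightarrow> int (card F) \<le> int 2 * int (card (edge_ends H F)) - int 3)
        \<and> int (card F) \<le> int 2 * int (card (edge_ends H F)) - int 2" if "F \<subseteq> J" "F \<noteq> {}" for F
    using J(2) that unfolding gain_sparse_def by blast
  have hall: "card F + 1 \<le> 2 * dim ((\<lambda>e. incidence_fun (\<epsilon> e) (tail H e) (head H e)) ` F)"
    if F: "F \<subseteq> J" "F \<noteq> {}" for F
  proof (rule card_le_incidence_dim[OF finite_subset[OF F(1) finJ] F(2)])
    fix F' assume F': "F' \<subseteq> F" "F' \<noteq> {}"
    then have FJ: "F' \<subseteq> J" using F(1) by blast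
    from sp[OF FJ F'(2)] show "card F' + 1 \<le> 2 * card (tail H ` F' \<union> head H ` F')"
      unfolding edge_ends_def by linarith
    assume pot: "has_potential (tail H) (head H) (\<lambda>e. \<epsilon> e) F'"
    have "balanced (integer_mod_group 2) H \<psi> F'"
      by (rule has_potential_imp_balanced[OF _ gain pot]) (use FJ J(1) in auto)
    with sp[OF FJ F'(2)] show "card F' + 1 + 2 \<le> 2 * card (tail H ` F' \<union> head H ` F')"
      unfolding edge_ends_def by linarith
  qed (simp add: gain_sign_def)
  have hall': "card F \<le> 2 * dim ((\<lambda>e. incidence_fun 1 (tail H e) (head H e)) ` F)" if F: "F \<subseteq> J" for F
  proof (cases "F = {}")
    case False
    \<comment> \<open>With all signs 1, every edge set has the constant potential, so the bound with
      the additional 2 must hold for all subsets: this is the general part of the (2,3,2)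
      count.\<close>
    have "card F + 0 \<le> 2 * dim ((\<lambda>e. incidence_fun 1 (tail H e) (head H e)) ` F)"
    proof (rule card_le_incidence_dim[OF finite_subset[OF F finJ] False, where \<eta> = "\<lambda>_. 1"])
      fix F' assume F': "F' \<subseteq> F" "F' \<noteq> {}"
      then have "F' \<subseteq> J" using F by blast
      from sp[OF this F'(2)]
      show "card F' + 0 + 2 \<le> 2 * card (tail H ` F' \<union> head H ` F')"
        and "card F' + 0 \<le> 2 * card (tail H ` F' \<union> head H ` F')"
        unfolding edge_ends_def by linarith+
    qed simp
    then show ?thesis by simp
  qed simp
  from ex_realization_with_indep_rows[OF finJ hall hall']
  show ?thesis by (simp add: anti_row_def[abs_def] edge_vec_def)
qed

lemma edge_vec_affine: "edge_vec (q + s *\<^sub>R (q' - q)) a = edge_vec q a + s *\<^sub>R (edge_vec q' a - edge_vec q a)"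
  by (simp add: edge_vec_def algebra_simps)

text \<open>Edge vectors are required to be nonzero on all arcs, also outside \<open>I\<close> and
  \<open>J\<close>, because a framework may not collapse any edge.\<close>

lemma ex_simultaneous_realization:
  assumes "I \<subseteq> arcs H" "\<exists>P. indep_family I (sym_row P)" "J \<subseteq> arcs H" "\<exists>P. indep_family J (anti_row P)"
  shows "\<exists>P. indep_family I (sym_row P) \<and> indep_family J (anti_row P) \<and> (\<forall>a\<in>arcs H. edge_vec P a \<noteq> 0)"
proof -
  have finIJ: "finite I" "finite J" using assms(1,3) finite_arcs finite_subset by blast+
  have gI: "line_generic UNIV (\<lambda>P. indep_family I (sym_row P))"
    unfolding sym_row_def[abs_def] by (rule line_generic_tensor[OF finIJ(1)]) (rule edge_vec_affine)
  have gJ: "line_generic UNIV (\<lambda>P. indep_family J (anti_row P))"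
    unfolding anti_row_def[abs_def] by (rule line_generic_tensor[OF finIJ(2)]) (rule edge_vec_affine)
  have gA: "line_generic UNIV (\<lambda>P. edge_vec P a \<noteq> 0)" for a
    by (rule line_generic_nonzero) (rule edge_vec_affine)
  have nz: "\<exists>P. edge_vec P a \<noteq> 0" if a: "a \<in> arcs H" for a
  proof -
    define P :: "'v set \<Rightarrow> real^2" where "P = (\<lambda>X. if X = tail H a then axis 1 1 else 0)"
    \<comment> \<open>A loop comes from an edge with two distinct ends, so its sign is -1 and its
      edge vector is twice the placed point.\<close>
    have "\<psi> a \<noteq> 0" if "head H a = tail H a"
      using arc_edges(3)[OF a] that by (auto simp: other_end_def)
    then have "edge_vec P a $ 1 \<noteq> 0"
      by (auto simp: edge_vec_def P_def gain_sign_def axis_def)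
    then have "edge_vec P a \<noteq> 0" by auto
    then show ?thesis by blast
  qed
  define C where "C = (\<lambda>k P. case k of Inl b \<Rightarrow>
      if b then indep_family I (sym_row P) else indep_family J (anti_row P) | Inr a \<Rightarrow> edge_vec P a \<noteq> 0)"
  have "\<exists>P\<in>UNIV. \<forall>k\<in>UNIV <+> arcs H. C k P"
  proof (rule line_generic_ex_Ball)
    have C: "C (Inl True) = (\<lambda>P. indep_family I (sym_row P))" "C (Inl False) = (\<lambda>P. indep_family J (anti_row P))"
      "C (Inr a) = (\<lambda>P. edge_vec P a \<noteq> 0)" for a
      by (simp_all add: C_def)
    fix k :: "bool + 'v set set" assume "k \<in> UNIV <+> arcs H"
    then consider "k = Inl True" | "k = Inl False" | a where "a \<in> arcs H" "k = Inr a" by auto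
    then have "line_generic UNIV (C k) \<and> (\<exists>P. C k P)"
      by cases (use gI gJ gA assms(2,4) nz in \<open>simp_all add: C\<close>)
    then show "line_generic UNIV (C k)" "\<exists>P\<in>UNIV. C k P" by simp_all
  qed (use finite_arcs in auto)
  then obtain P where P: "\<And>k. k \<in> UNIV <+> arcs H \<Longrightarrow> C k P" by blast
  have "indep_family I (sym_row P)" "indep_family J (anti_row P)"
    using P[OF InlI[OF UNIV_I, of True]] P[OF InlI[OF UNIV_I, of False]] by (simp_all add: C_def)
  moreover have "edge_vec P a \<noteq> 0" if "a \<in> arcs H" for a
    using P[OF InrI[OF that]] by (simp add: C_def)
  ultimately show ?thesis by blast
qed

text \<open>The competitor against which the maximality of a regular framework is tested.\<close>

lemma ex_odd_realization:
  "\<exists>p :: 'v \<Rightarrow> real^2. (\<forall>v\<in>V. p (\<gamma> v) = - p v) \<and> (\<forall>u\<in>V. \<forall>v\<in>V. {u, v} \<in> E \<longrightarrow> p u \<noteq> p v) \<and>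
    gain_matroid_rank (integer_mod_group 2) H \<psi> 2 3 1 + gain_matroid_rank (integer_mod_group 2) H \<psi> 2 3 2
      \<le> dim (edge_row p ` E)"
proof -
  obtain I where I: "I \<subseteq> arcs H" "gain_sparse (integer_mod_group 2) H \<psi> 2 3 1 I"
    "card I = gain_matroid_rank (integer_mod_group 2) H \<psi> 2 3 1"
    using gain_matroid_rank_attained[OF finite_arcs] by blast
  obtain J where J: "J \<subseteq> arcs H" "gain_sparse (integer_mod_group 2) H \<psi> 2 3 2 J"
    "card J = gain_matroid_rank (integer_mod_group 2) H \<psi> 2 3 2"
    using gain_matroid_rank_attained[OF finite_arcs] by blast
  obtain P where P: "indep_family I (sym_row P)" "indep_family J (anti_row P)"
    "\<And>a. a \<in> arcs H \<Longrightarrow> edge_vec P a \<noteq> 0"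
    using ex_simultaneous_realization[OF I(1) ex_sym_realization[OF I(1,2)] J(1) ex_anti_realization[OF J(1,2)]]
    by blast
  \<comment> \<open>The odd extension of a placement of the representatives.\<close>
  define p where "p = (\<lambda>v. orient v *\<^sub>R P (orb v))"
  have odd: "p (\<gamma> v) = - p v" if v: "v \<in> V" for v
  proof -
    have X: "orb v \<in> verts H" using v by (auto simp: verts)
    have "v = r (orb v) \<or> v = \<gamma> (r (orb v))" using orb_eq_iff[OF X v] by simp
    then have "orient (\<gamma> v) = - orient v"
      using orient_rep[OF X] orient_\<gamma>_rep[OF X] rep_in_V[OF X] by (metis \<gamma>_\<gamma> minus_minus)
    then show ?thesis unfolding p_def orb_\<gamma>[OF v] by simp
  qed
  have pr: "(p \<circ> r) X = P X" if "X \<in> verts H" for X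
    using that by (simp add: p_def orient_rep orb_rep)
  have ev: "edge_vec (p \<circ> r) a = edge_vec P a" if "a \<in> arcs H" for a
    using pr ends[OF that] by (simp add: edge_vec_def del: o_apply)
  have rows: "sym_row (p \<circ> r) a = sym_row P a" "anti_row (p \<circ> r) a = anti_row P a" if "a \<in> arcs H" for a
    by (simp_all add: sym_row_def anti_row_def ev[OF that])
  have cong: "indep_family K f \<longleftrightarrow> indep_family K g" if "\<And>a. a \<in> K \<Longrightarrow> f a = g a" for K and f g :: "'v set set \<Rightarrow> 'v set \<times> 2 \<Rightarrow> real"
    using that unfolding indep_family_def by (metis (no_types, lifting) sum.cong)
  have indI: "indep_family I (sym_row (p \<circ> r))"
    using P(1) cong[of I "sym_row (p \<circ> r)" "sym_row P"] rows(1) I(1) by blast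
  have indJ: "indep_family J (anti_row (p \<circ> r))"
    using P(2) cong[of J "anti_row (p \<circ> r)" "anti_row P"] rows(2) J(1) by blast
  have "card I + card J \<le> dim (edge_row p ` E)"
    by (rule card_indep_rows_le_rank[where p = p, OF odd I(1) indI J(1) indJ])
  moreover have "p u \<noteq> p v" if uv: "u \<in> V" "v \<in> V" "{u, v} \<in> E" for u v
  proof
    assume eq: "p u = p v"
    obtain a where a: "a \<in> arcs H" "{u, v} \<in> a" using edge_in_arc uv(3) by blast
    have nz: "p (r (tail H a)) \<noteq> p (other_end a)"
      using edge_vec_eq[where p = p, OF odd a(1)] P(3)[OF a(1)] ev[OF a(1)] by auto
    have "p (\<gamma> (r (tail H a))) = - p (r (tail H a))" "p (\<gamma> (other_end a)) = - p (other_end a)"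
      using odd rep_in_V[OF ends(1)[OF a(1)]] other_end_in_V[OF a(1)] by auto
    then have nz': "p (\<gamma> (r (tail H a))) \<noteq> p (\<gamma> (other_end a))" using nz by simp
    have "{u, v} = {r (tail H a), other_end a} \<or> {u, v} = {\<gamma> (r (tail H a)), \<gamma> (other_end a)}"
      by (rule edge_in_arc_cases[OF a])
    with eq nz nz' show False by (auto simp: doubleton_eq_iff)
  qed
  ultimately show ?thesis using odd I(3) J(3) by (intro exI[of _ p]) auto
qed

end

section \<open>From the group-theoretic hypotheses to the quotient data\<close>

text \<open>The neutral element is sent to an idempotent, which minus the identity is not;
  injectivity leaves only the half-turn for the generator.\<close>

lemma half_turn_group_mon_values:
  assumes "\<tau> \<in> mon (integer_mod_group 2) half_turn_group"
  shows "\<tau> 0 = Finite_Cartesian_Product.mat 1" "\<tau> 1 = - Finite_Cartesian_Product.mat 1"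
proof -
  have hom: "\<tau> \<in> hom (integer_mod_group 2) half_turn_group" and inj: "inj_on \<tau> {0, 1}"
    using assms by (auto simp: mon_def carrier_integer_mod_group_2)
  have c: "\<tau> 0 \<in> {Finite_Cartesian_Product.mat 1, - Finite_Cartesian_Product.mat 1}"
    "\<tau> 1 \<in> {Finite_Cartesian_Product.mat 1, - Finite_Cartesian_Product.mat 1}"
    using hom_in_carrier[OF hom, of 0] hom_in_carrier[OF hom, of 1]
    by (simp_all add: half_turn_group_def carrier_integer_mod_group_2)
  have "\<tau> 0 = \<tau> 0 ** \<tau> 0"
    using hom_mult[OF hom, of 0 0] by (simp add: half_turn_group_def carrier_integer_mod_group_2)
  moreover have "(- Finite_Cartesian_Product.mat 1 :: real^2^2) ** - Finite_Cartesian_Product.mat 1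
      = Finite_Cartesian_Product.mat 1"
    by (simp add: matrix_matrix_mult_def Finite_Cartesian_Product.mat_def
        Finite_Cartesian_Product.vec_eq_iff forall_2 sum_2)
  ultimately show 0: "\<tau> 0 = Finite_Cartesian_Product.mat 1" using c(1) by auto
  have "\<tau> 0 \<noteq> \<tau> 1" using inj by (auto simp: inj_on_def)
  with 0 c(2) show "\<tau> 1 = - Finite_Cartesian_Product.mat 1" by auto
qed

lemma integer_mod_group_2_action:
  assumes \<theta>: "\<theta> \<in> hom (integer_mod_group 2) (graph_aut_group V E)"
  shows "\<And>v. v \<in> V \<Longrightarrow> \<theta> 0 v = v" "\<And>v. v \<in> V \<Longrightarrow> \<theta> 1 v \<in> V" "\<And>v. v \<in> V \<Longrightarrow> \<theta> 1 (\<theta> 1 v) = v"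
    and "\<And>u v. u \<in> V \<Longrightarrow> v \<in> V \<Longrightarrow> {u, v} \<in> E \<longleftrightarrow> {\<theta> 1 u, \<theta> 1 v} \<in> E"
proof -
  have aut: "\<theta> g \<in> Bij V \<and> (\<forall>u\<in>V. \<forall>v\<in>V. {u, v} \<in> E \<longleftrightarrow> {\<theta> g u, \<theta> g v} \<in> E)" if "g \<in> {0, 1}" for g
    using hom_in_carrier[OF \<theta>, of g] that by (auto simp: graph_aut_group_def carrier_integer_mod_group_2)
  have mult: "\<theta> ((g + h) mod 2) = compose V (\<theta> g) (\<theta> h)" if "g \<in> {0, 1}" "h \<in> {0, 1}" for g h
    using hom_mult[OF \<theta>, of g h] that aut[OF that(1)] aut[OF that(2)]
    by (simp add: graph_aut_group_def BijGroup_def carrier_integer_mod_group_2)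
  have bij: "bij_betw (\<theta> g) V V" if "g \<in> {0, 1}" for g
    using aut[OF that] by (auto simp: Bij_def)
  show id: "\<theta> 0 v = v" if v: "v \<in> V" for v
  proof -
    \<comment> \<open>\<open>\<theta> 0\<close> is idempotent since 0 + 0 = 0, and an injective
      idempotent map is the identity.\<close>
    have "\<theta> 0 v = \<theta> 0 (\<theta> 0 v)" using fun_cong[OF mult[of 0 0], of v] v by (simp add: compose_def)
    moreover have "\<theta> 0 v \<in> V" using bij_betwE[OF bij[of 0]] v by simp
    ultimately show ?thesis
      using inj_onD[OF bij_betw_imp_inj_on[OF bij[of 0]], of "\<theta> 0 v" v] v by simp
  qed
  show "\<theta> 1 v \<in> V" if "v \<in> V" for v using bij_betwE[OF bij[of 1]] that by simp
  show "\<theta> 1 (\<theta> 1 v) = v" if v: "v \<in> V" for v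
    using fun_cong[OF mult[of 1 1], of v] v id[OF v] by (simp add: compose_def)
  show "{u, v} \<in> E \<longleftrightarrow> {\<theta> 1 u, \<theta> 1 v} \<in> E" if "u \<in> V" "v \<in> V" for u v
    using aut[of 1] that by blast
qed

theorem theorem6p9:
  fixes V :: "'v set" and E :: "'v set set"
    and \<theta> :: "int \<Rightarrow> 'v \<Rightarrow> 'v" and \<tau> :: "int \<Rightarrow> real^2^2" and p :: "'v \<Rightarrow> real^2"
    and H :: "('v set, 'v set set) pre_digraph" and \<psi> :: "'v set set \<Rightarrow> int"
  defines "\<Gamma> \<equiv> integer_mod_group 2"
  assumes "\<tau> \<in> mon \<Gamma> half_turn_group"
    and "simple_graph V E"
    and "\<theta> \<in> hom \<Gamma> (graph_aut_group V E)"
    and "free_action \<Gamma> V \<theta>"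
    and "symmetric_regular \<Gamma> V E \<theta> \<tau> p"
    and "quotient_gain_graph \<Gamma> V E \<theta> H \<psi>"
  shows "rigidity_rank V E p = gain_matroid_rank \<Gamma> H \<psi> 2 3 1 + gain_matroid_rank \<Gamma> H \<psi> 2 3 2"
proof -
  define \<gamma> where "\<gamma> = \<theta> 1"
  note act = integer_mod_group_2_action[OF assms(4)[unfolded \<Gamma>_def], folded \<gamma>_def]
  note tau = half_turn_group_mon_values[OF assms(2)[unfolded \<Gamma>_def]]
  have carrier: "carrier \<Gamma> = {0, 1}" by (simp add: \<Gamma>_def carrier_integer_mod_group_2)
  have EV: "e \<subseteq> V \<and> card e = 2" if "e \<in> E" for e using assms(3) that by (auto simp: simple_graph_def)
  have id_img: "\<theta> 0 ` e = e" if "e \<in> E" for e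
    using EV[OF that] act(1) by (auto simp: subset_iff image_iff)
  have "\<exists>r. (\<forall>X\<in>verts H. r X \<in> X) \<and>
       (\<forall>a\<in>arcs H. tail H a \<in> verts H \<and> head H a \<in> verts H \<and> \<psi> a \<in> carrier \<Gamma> \<and>
          a = {{\<theta> g (r (tail H a)), \<theta> (g \<otimes>\<^bsub>\<Gamma>\<^esub> \<psi> a) (r (head H a))} | g. g \<in> carrier \<Gamma>})"
    using conjunct2[OF conjunct2[OF assms(7)[unfolded quotient_gain_graph_def]]] .
  then obtain r where rep_arc: "(\<forall>X\<in>verts H. r X \<in> X) \<and>
       (\<forall>a\<in>arcs H. tail H a \<in> verts H \<and> head H a \<in> verts H \<and> \<psi> a \<in> carrier \<Gamma> \<and>
          a = {{\<theta> g (r (tail H a)), \<theta> (g \<otimes>\<^bsub>\<Gamma>\<^esub> \<psi> a) (r (head H a))} | g. g \<in> carrier \<Gamma>})" ..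
  note r = bspec[OF conjunct1[OF rep_arc]] and a = bspec[OF conjunct2[OF rep_arc]]
  have orbit: "orbit \<Gamma> \<phi> x = {\<phi> 0 x, \<phi> 1 x}" for \<phi> :: "int \<Rightarrow> 'v \<Rightarrow> 'v" and x
    unfolding orbit_def carrier Setcompr_eq_image by simp
  have "orbit \<Gamma> \<theta> v = {v, \<gamma> v}" if "v \<in> V" for v
    using act(1)[OF that] by (simp add: orbit \<gamma>_def)
  then have verts: "verts H = (\<lambda>v. {v, \<gamma> v}) ` V"
    unfolding conjunct1[OF assms(7)[unfolded quotient_gain_graph_def]] orbits_def Setcompr_eq_image
    by (rule image_cong[OF refl])
  have orbit_edges: "orbit \<Gamma> \<phi> e = {\<phi> 0 e, \<phi> 1 e}" for \<phi> :: "int \<Rightarrow> 'v set \<Rightarrow> 'v set" and e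
    unfolding orbit_def carrier Setcompr_eq_image by simp
  have "orbit \<Gamma> (\<lambda>g e. \<theta> g ` e) e = {e, \<gamma> ` e}" if "e \<in> E" for e
    using id_img[OF that] by (simp add: orbit_edges \<gamma>_def)
  then have arcs: "arcs H = (\<lambda>e. {e, \<gamma> ` e}) ` E"
    unfolding conjunct1[OF conjunct2[OF assms(7)[unfolded quotient_gain_graph_def]]] orbits_def
      Setcompr_eq_image
    by (rule image_cong[OF refl])
  have rep_in: "r X \<in> V" if X: "X \<in> verts H" for X
  proof -
    obtain v where "v \<in> V" "X = {v, \<gamma> v}" using X unfolding verts by blast
    then show ?thesis using r[OF X] act(2) by auto
  qed
  interpret half_turn_quotient V E \<gamma> H \<psi> r
  proof
    show "\<gamma> v \<noteq> v" if "v \<in> V" for v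
      using assms(5) that by (auto simp: free_action_def carrier \<gamma>_def \<Gamma>_def)
    show "\<gamma> ` e \<in> E" if e: "e \<in> E" for e
    proof -
      obtain u v where uv: "e = {u, v}" using EV[OF e] by (auto simp: card_2_iff)
      then show ?thesis using act(4)[of u v] EV[OF e] e by auto
    qed
    fix b assume b: "b \<in> arcs H"
    show "tail H b \<in> verts H" "head H b \<in> verts H" using a[OF b] by auto
    show gain: "\<psi> b \<in> {0, 1}" using a[OF b] carrier by blast
    have V: "r (tail H b) \<in> V" "r (head H b) \<in> V"
      using rep_in a[OF b] by auto
    have "b = {{\<theta> g (r (tail H b)), \<theta> ((g + \<psi> b) mod 2) (r (head H b))} | g. g \<in> {0, 1}}"
      using a[OF b] unfolding carrier by (simp add: \<Gamma>_def)
    also have "\<dots> = (\<lambda>g. {\<theta> g (r (tail H b)), \<theta> ((g + \<psi> b) mod 2) (r (head H b))}) ` {0, 1}"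
      by blast
    \<comment> \<open>For gain 1 and \<open>g = 1\<close> the second endpoint is the representative
      itself, which agrees with \<open>\<gamma>\<close> applied twice.\<close>
    also have "\<dots> = {{r (tail H b), if \<psi> b = 0 then r (head H b) else \<gamma> (r (head H b))},
        \<gamma> ` {r (tail H b), if \<psi> b = 0 then r (head H b) else \<gamma> (r (head H b))}}"
      using gain act(1)[OF V(1)] act(1)[OF V(2)] act(3)[OF V(2)] by (auto simp: \<gamma>_def)
    finally show "b = {{r (tail H b), if \<psi> b = 0 then r (head H b) else \<gamma> (r (head H b))},
        \<gamma> ` {r (tail H b), if \<psi> b = 0 then r (head H b) else \<gamma> (r (head H b))}}" .
  qed (use assms(3) act r verts arcs in auto)
  have sym_iff: "symmetric_framework \<Gamma> V E \<theta> \<tau> q \<longleftrightarrow>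
      (\<forall>u\<in>V. \<forall>v\<in>V. {u, v} \<in> E \<longrightarrow> q u \<noteq> q v) \<and> (\<forall>v\<in>V. q (\<gamma> v) = - q v)" for q
  proof -
    have "(- Finite_Cartesian_Product.mat 1 :: real^2^2) *v x = - x" for x
      by (simp add: matrix_vector_mult_def Finite_Cartesian_Product.mat_def
          Finite_Cartesian_Product.vec_eq_iff forall_2 sum_2)
    then have "(\<forall>g\<in>carrier \<Gamma>. \<forall>v\<in>V. \<tau> g *v q v = q (\<theta> g v)) \<longleftrightarrow> (\<forall>v\<in>V. q (\<gamma> v) = - q v)"
      using act(1) by (auto simp: carrier tau \<gamma>_def)
    then show ?thesis using assms(3) by (auto simp: symmetric_framework_def is_framework_def)
  qed
  note rank = rigidity_rank_eq_dim[OF assms(3)]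
  have p: "symmetric_framework \<Gamma> V E \<theta> \<tau> p"
    and max: "\<And>q. symmetric_framework \<Gamma> V E \<theta> \<tau> q \<Longrightarrow> rigidity_rank V E q \<le> rigidity_rank V E p"
    using assms(6) by (auto simp: symmetric_regular_def)
  have "rigidity_rank V E p \<le> gain_matroid_rank \<Gamma> H \<psi> 2 3 1 + gain_matroid_rank \<Gamma> H \<psi> 2 3 2"
    unfolding rank \<Gamma>_def by (rule rank_le_gain_matroid_ranks) (use p sym_iff in blast)+
  \<comment> \<open>Regularity makes the rank of \<open>p\<close> at least that of this
    realization.\<close>
  moreover obtain q where "symmetric_framework \<Gamma> V E \<theta> \<tau> q"
    "gain_matroid_rank \<Gamma> H \<psi> 2 3 1 + gain_matroid_rank \<Gamma> H \<psi> 2 3 2 \<le> rigidity_rank V E q"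
    using ex_odd_realization[folded \<Gamma>_def] unfolding sym_iff rank by blast
  ultimately show ?thesis using max[of q] by linarith
qed

end
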